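(* Let $R$ be a regular domain, let $\mathbf x=x_1,\dots,x_d$ be a generalized regular system of parameters of $R$, and let $I=(\mathbf x^{\mathbf a_1},\dots,\mathbf x^{\mathbf a_s})$ be an ideal generated by monomials in $\mathbf x$. Then for every $w\in\mathbb Q_{\geqslant0}$, the ideal $\overline{I^w}$ is generated by the monomials $\mathbf x^{\mathbf e}$ with $\mathbf e\in\mathbb Z^d_{\geqslant0}\cap w\operatorname{NP}(I)$.
   Context: A generalized regular system of parameters of a regular domain $R$ is a permutable regular sequence $\mathbf x=x_1,\dots,x_d$ such that for every subsequence $\mathbf x'=x_{i_1},\dots,x_{i_r}$ of $\mathbf x$ the ring $R/(\mathbf x')$ is again a regular domain. For $\mathbf a=(a_1,\dots,a_d)\in\mathbb Z^d_{\geqslant0}$, $\mathbf x^{\mathbf a}:=x_1^{a_1}\cdots x_d^{a_d}$. The Newton polyhedron is $\operatorname{NP}(I):=\operatorname{conv}(\mathbf a_1,\dots,\mathbf a_s)+\mathbb R^d_{\geqslant0}$. For $w=p/q\in\mathbb Q_{\geqslant0}$, $\overline{I^w}:=\{x\in R\mid x^q\in\overline{I^p}\}$, where the overline denotes integral closure. *)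

theory Defs
  imports "HOL-Analysis.Analysis" "HOL-Algebra.Algebra" "HOL-Combinatorics.Permutations"
begin

definition prime_height :: "('a, 'b) ring_scheme \<Rightarrow> 'a set \<Rightarrow> enat" where
  "prime_height R P = Sup {enat (length Ps - 1) | Ps. Ps \<noteq> [] \<and> last Ps = P \<and>
      sorted_wrt (\<subset>) Ps \<and> (\<forall>Q \<in> set Ps. primeideal Q R)}"

text \<open>Minimal number of generators of the maximal ideal P R_P of the localization R_P.
  (a_1/1,...,a_n/1) = P R_P  iff  every p in P satisfies t p in (a_1..a_n) for some t not in P.\<close>
definition loc_num_gens :: "('a, 'b) ring_scheme \<Rightarrow> 'a set \<Rightarrow> nat" where
  "loc_num_gens R P = (LEAST n. \<exists>as. length as = n \<and> set as \<subseteq> P \<and>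
      (\<forall>p\<in>P. \<exists>t \<in> carrier R - P. t \<otimes>\<^bsub>R\<^esub> p \<in> genideal R (set as)))"

text \<open>Regular ring: Noetherian, and every localization R_P at a prime P is a regular
  local ring, i.e. embedding dimension of R_P equals dim R_P = ht P.\<close>
definition regular_ring :: "('a, 'b) ring_scheme \<Rightarrow> bool" where
  "regular_ring R \<longleftrightarrow> cring R \<and> noetherian_ring R \<and>
     (\<forall>P. primeideal P R \<longrightarrow> enat (loc_num_gens R P) = prime_height R P)"

definition regular_domain :: "('a, 'b) ring_scheme \<Rightarrow> bool" where
  "regular_domain R \<longleftrightarrow> regular_ring R \<and> domain R"

definition regular_seq :: "('a, 'b) ring_scheme \<Rightarrow> (nat \<Rightarrow> 'a) \<Rightarrow> nat \<Rightarrow> bool" where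
  "regular_seq R x d \<longleftrightarrow> (\<forall>i<d. x i \<in> carrier R) \<and>
     genideal R (x ` {..<d}) \<noteq> carrier R \<and>
     (\<forall>i<d. \<forall>r \<in> carrier R. x i \<otimes>\<^bsub>R\<^esub> r \<in> genideal R (x ` {..<i}) \<longrightarrow>
                              r \<in> genideal R (x ` {..<i}))"

definition permutable_regular_seq :: "('a, 'b) ring_scheme \<Rightarrow> (nat \<Rightarrow> 'a) \<Rightarrow> nat \<Rightarrow> bool" where
  "permutable_regular_seq R x d \<longleftrightarrow> (\<forall>\<sigma>. \<sigma> permutes {..<d} \<longrightarrow> regular_seq R (x \<circ> \<sigma>) d)"

text \<open>Generalized regular system of parameters. Subsequences correspond to index subsets S.\<close>
definition gen_reg_sop :: "('a, 'b) ring_scheme \<Rightarrow> (nat \<Rightarrow> 'a) \<Rightarrow> nat \<Rightarrow> bool" where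
  "gen_reg_sop R x d \<longleftrightarrow> permutable_regular_seq R x d \<and>
     (\<forall>S \<subseteq> {..<d}. regular_domain (R Quot genideal R (x ` S)))"

definition monomial :: "('a, 'b) ring_scheme \<Rightarrow> (nat \<Rightarrow> 'a) \<Rightarrow> nat \<Rightarrow> (nat \<Rightarrow> nat) \<Rightarrow> 'a" where
  "monomial R x d e = finprod R (\<lambda>i. x i [^]\<^bsub>R\<^esub> e i) {..<d}"

fun ideal_pow :: "('a, 'b) ring_scheme \<Rightarrow> 'a set \<Rightarrow> nat \<Rightarrow> 'a set" where
  "ideal_pow R I 0 = carrier R"
| "ideal_pow R I (Suc n) = ideal_prod R I (ideal_pow R I n)"

definition int_closure :: "('a, 'b) ring_scheme \<Rightarrow> 'a set \<Rightarrow> 'a set" where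
  "int_closure R I = {r \<in> carrier R. \<exists>n\<ge>1. \<exists>c. (\<forall>i\<in>{1..n}. c i \<in> ideal_pow R I i) \<and>
      r [^]\<^bsub>R\<^esub> n \<oplus>\<^bsub>R\<^esub> (finsum R (\<lambda>i. c i \<otimes>\<^bsub>R\<^esub> r [^]\<^bsub>R\<^esub> (n - i)) {1..n}) = \<zero>\<^bsub>R\<^esub>}"

definition rat_power_closure :: "('a, 'b) ring_scheme \<Rightarrow> 'a set \<Rightarrow> rat \<Rightarrow> 'a set" where
  "rat_power_closure R I w = (case quotient_of w of (p, q) \<Rightarrow>
      {r \<in> carrier R. r [^]\<^bsub>R\<^esub> nat q \<in> int_closure R (ideal_pow R I (nat p))})"

text \<open>Newton polyhedron conv(a_1..a_s) + R^d_{\<ge>0}, points of R^d encoded as nat \<Rightarrow> real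
  vanishing outside {..<d}; A is finite, so conv(A) = convex combinations of elements of A.\<close>
definition newton_polyhedron :: "nat \<Rightarrow> (nat \<Rightarrow> nat) set \<Rightarrow> (nat \<Rightarrow> real) set" where
  "newton_polyhedron d A = {y. (\<forall>i\<ge>d. y i = 0) \<and>
     (\<exists>lam :: (nat \<Rightarrow> nat) \<Rightarrow> real. (\<forall>a\<in>A. lam a \<ge> 0) \<and> (\<Sum>a\<in>A. lam a) = 1 \<and>
        (\<forall>i<d. y i \<ge> (\<Sum>a\<in>A. lam a * real (a i))))}"

definition scale_set :: "real \<Rightarrow> (nat \<Rightarrow> real) set \<Rightarrow> (nat \<Rightarrow> real) set" where
  "scale_set c S = (\<lambda>y i. c * y i) ` S"

end

theory Submission
  imports Defs
begin

text \<open>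
  Let \<open>P\<close> be the ideal generated by all the parameters. Since all ideals generated by subsets of the
  parameters are prime, colon ideals of monomial ideals by monomials are computed as in a polynomial
  ring. With Krull's intersection argument this shows that every monomial ideal is the intersection of the
  ideals \<open>(x\<^sub>1\<^bsup>b\<^sub>1+1\<^esup>, \<dots>, x\<^sub>d\<^bsup>b\<^sub>d+1\<^esup>)\<close> over the exponents \<open>b\<close> of the monomials outside it.

  Suppose \<open>r\<close> is not in the ideal generated by the monomials with exponents in \<open>w NP(I)\<close>. Choose such a \<open>b\<close> with
  \<open>r\<close> outside the corresponding ideal, and separate \<open>b\<close> from \<open>w NP(I)\<close> by positive weights that take distinct
  values on distinct exponents. Then \<open>r\<close> has a leading term \<open>u x\<^sup>f\<close> with \<open>u \<notin> P\<close> and weight at most that of \<open>b\<close>, and its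
  powers have leading terms \<open>u\<^sup>k x\<^bsup>k f\<^esup>\<close>; comparing weights contradicts any equation of integral dependence.

  Conversely, let \<open>y\<close> be in the ideal of the monomials with exponents in \<open>p NP(I)\<close>, and let \<open>H\<close> be the ideal of the
  monomials with exponents in \<open>s NP(I)\<close>, where \<open>s\<close> is the number of generators of \<open>I\<close>. Rounding
  coefficients down shows \<open>y H \<subseteq> I\<^sup>p H\<close>, so the determinant trick applies.
\<close>

section \<open>Ideals\<close>

text \<open>\<open>R\<close> need not be local, so two familiar devices fail: an element may lie in
  every ideal of a weight filtration, and Krull's argument leaves a factor
  \<open>\<one> \<ominus> c \<otimes> x i\<close> that need not be a unit. Both are repaired without
  localizing. The factor lies outside the prime ideal \<open>P\<close>, and elements outside
  \<open>P\<close> are nonzerodivisors modulo ideals generated by monomials. The order of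
  \<open>r\<close> is only sought up to the weight of \<open>b\<close>: everything of larger weight
  lies in the ideal attached to \<open>b\<close>, which omits \<open>r\<close>, so the search stops.

  Distinct weights leave one monomial in each graded piece, so a leading coefficient is a single
  element of \<open>R\<close>, and primality of \<open>P\<close> keeps its powers outside
  \<open>P\<close>. This stands in for the associated graded ring being a domain. Strict separation
  from finitely many vertices is an open condition, which leaves room to perturb the weights until
  they are distinct.\<close>

context cring
begin

lemma ideal_of_closedI:
  assumes "S \<subseteq> carrier R" "\<zero> \<in> S"
    and "\<And>a b. a \<in> S \<Longrightarrow> b \<in> S \<Longrightarrow> a \<oplus> b \<in> S"
    and "\<And>c a. c \<in> carrier R \<Longrightarrow> a \<in> S \<Longrightarrow> c \<otimes> a \<in> S"
  shows "ideal S R"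
proof (rule idealI[OF ring_axioms])
  have "\<ominus> a \<in> S" if "a \<in> S" for a
    using assms(4)[of "\<ominus> \<one>" a] that assms(1) l_minus[of \<one> a] by auto
  then show "subgroup S (add_monoid R)"
    by (intro subgroup.intro) (use assms in \<open>auto simp flip: a_inv_def\<close>)
  show "a \<otimes> c \<in> S" if "a \<in> S" "c \<in> carrier R" for a c
    using assms(1,4) that m_comm[of a c] by auto
qed (use assms in auto)

lemma ideal_add: "ideal I R \<Longrightarrow> a \<in> I \<Longrightarrow> b \<in> I \<Longrightarrow> a \<oplus> b \<in> I"
  by (simp add: additive_subgroup.a_closed ideal.axioms(1))

lemma ideal_zero: "ideal I R \<Longrightarrow> \<zero> \<in> I"
  by (simp add: additive_subgroup.zero_closed ideal.axioms(1))

lemma ideal_minus: "ideal I R \<Longrightarrow> a \<in> I \<Longrightarrow> b \<in> I \<Longrightarrow> a \<ominus> b \<in> I"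
  by (simp add: additive_subgroup.a_closed additive_subgroup.a_inv_closed ideal.axioms(1) minus_eq)

lemma Idl_mono: "B \<subseteq> Y \<Longrightarrow> Y \<subseteq> carrier R \<Longrightarrow> Idl B \<subseteq> Idl Y"
  by (meson subset_Idl_subset genideal_self order_trans)

lemma Idl_subsetI: "ideal I R \<Longrightarrow> B \<subseteq> I \<Longrightarrow> Idl B \<subseteq> I"
  by (rule genideal_minimal)

lemma Idl_carrier: "B \<subseteq> carrier R \<Longrightarrow> y \<in> Idl B \<Longrightarrow> y \<in> carrier R"
  by (meson genideal_ideal ideal.Icarr)

lemma ideal_colon:
  assumes "ideal I R" "c \<in> carrier R"
  shows "ideal {y \<in> carrier R. c \<otimes> y \<in> I} R"
proof (rule ideal_of_closedI)
  show "b \<otimes> a \<in> {y \<in> carrier R. c \<otimes> y \<in> I}"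
    if "b \<in> carrier R" "a \<in> {y \<in> carrier R. c \<otimes> y \<in> I}" for a b
    using that assms ideal.I_l_closed[OF assms(1), of "c \<otimes> a" b] by (auto simp: m_lcomm)
qed (use assms in \<open>auto simp: r_distr ideal_add ideal_zero\<close>)

lemma mult_Idl_subset:
  assumes "B \<subseteq> carrier R" "ideal I R" "c \<in> carrier R" "\<And>a. a \<in> B \<Longrightarrow> c \<otimes> a \<in> I" "y \<in> Idl B"
  shows "c \<otimes> y \<in> I"
  using Idl_subsetI[OF ideal_colon[OF assms(2,3)], of B] assms by auto

lemma mult_Idl_Idl:
  assumes B: "B \<subseteq> carrier R" and Y: "Y \<subseteq> carrier R" and I: "ideal I R"
    and prod: "\<And>a b. a \<in> B \<Longrightarrow> b \<in> Y \<Longrightarrow> a \<otimes> b \<in> I"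
    and y: "y \<in> Idl B" and z: "z \<in> Idl Y"
  shows "y \<otimes> z \<in> I"
proof -
  have yc: "y \<in> carrier R" and zc: "z \<in> carrier R" using Idl_carrier B Y y z by auto
  have "z \<otimes> a \<in> I" if "a \<in> B" for a
    using mult_Idl_subset[OF Y I _ _ z, of a] prod that B zc by (auto simp: m_comm subset_iff)
  then have "z \<otimes> y \<in> I" by (rule mult_Idl_subset[OF B I zc _ y])
  then show ?thesis by (simp add: m_comm yc zc)
qed

lemma Idl_Un_decomp:
  assumes B: "B \<subseteq> carrier R" and Y: "Y \<subseteq> carrier R" and z: "z \<in> Idl (B \<union> Y)"
  obtains a b where "a \<in> Idl B" "b \<in> Idl Y" "z = a \<oplus> b"
proof -
  have I: "ideal (Idl B <+> Idl Y) R"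
    by (intro add_ideals genideal_ideal B Y)
  have "B \<subseteq> Idl B <+> Idl Y"
  proof
    fix v assume v: "v \<in> B"
    have "v \<oplus> \<zero> \<in> Idl B <+> Idl Y"
      unfolding set_add_def' using genideal_self[OF B] v ideal_zero[OF genideal_ideal[OF Y]] by blast
    then show "v \<in> Idl B <+> Idl Y" using v B by auto
  qed
  moreover have "Y \<subseteq> Idl B <+> Idl Y"
  proof
    fix v assume v: "v \<in> Y"
    have "\<zero> \<oplus> v \<in> Idl B <+> Idl Y"
      unfolding set_add_def' using genideal_self[OF Y] v ideal_zero[OF genideal_ideal[OF B]] by blast
    then show "v \<in> Idl B <+> Idl Y" using v Y by auto
  qed
  ultimately have "z \<in> Idl B <+> Idl Y" using Idl_subsetI[OF I] z by blast
  then show thesis using that by (auto simp: set_add_def')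
qed

lemma Idl_singleton:
  assumes "a \<in> carrier R" "y \<in> Idl {a}"
  obtains c where "c \<in> carrier R" "y = c \<otimes> a"
  using assms cgenideal_eq_genideal[of a] by (auto simp: cgenideal_def)

lemma Idl_insert_decomp:
  assumes "B \<subseteq> carrier R" "a \<in> carrier R" "z \<in> Idl (insert a B)"
  obtains k c where "k \<in> Idl B" "c \<in> carrier R" "z = k \<oplus> c \<otimes> a"
proof -
  have "z \<in> Idl (B \<union> {a})" using assms by simp
  then obtain k b where "k \<in> Idl B" "b \<in> Idl {a}" "z = k \<oplus> b"
    using Idl_Un_decomp[of B "{a}" z] assms by auto
  then show thesis using that Idl_singleton[of a b] assms by metis
qed

lemma Idl_mult_image:
  assumes "B \<subseteq> carrier R" "c \<in> carrier R" "y \<in> Idl ((\<lambda>a. c \<otimes> a) ` B)"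
  obtains b where "b \<in> Idl B" "y = c \<otimes> b"
proof -
  have IX: "ideal (Idl B) R" using assms by (simp add: genideal_ideal)
  have "ideal {y. \<exists>b\<in>Idl B. y = c \<otimes> b} R"
  proof (rule ideal_of_closedI)
    show "{y. \<exists>b\<in>Idl B. y = c \<otimes> b} \<subseteq> carrier R"
      using assms Idl_carrier by auto
    show "\<zero> \<in> {y. \<exists>b\<in>Idl B. y = c \<otimes> b}"
      using assms ideal_zero[OF IX] by force
    show "a \<oplus> b \<in> {y. \<exists>b\<in>Idl B. y = c \<otimes> b}"
      if ab: "a \<in> {y. \<exists>b\<in>Idl B. y = c \<otimes> b}" "b \<in> {y. \<exists>b\<in>Idl B. y = c \<otimes> b}" for a b
    proof -
      obtain a' b' where *: "a' \<in> Idl B" "b' \<in> Idl B" "a = c \<otimes> a'" "b = c \<otimes> b'" using ab by auto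
      then have "a \<oplus> b = c \<otimes> (a' \<oplus> b')" using assms Idl_carrier[OF assms(1)] by (simp add: r_distr)
      then show ?thesis using ideal_add[OF IX] * by blast
    qed
    show "e \<otimes> a \<in> {y. \<exists>b\<in>Idl B. y = c \<otimes> b}"
      if ea: "e \<in> carrier R" "a \<in> {y. \<exists>b\<in>Idl B. y = c \<otimes> b}" for e a
    proof -
      obtain a' where *: "a' \<in> Idl B" "a = c \<otimes> a'" using ea by auto
      then have "e \<otimes> a = c \<otimes> (e \<otimes> a')" using assms ea Idl_carrier[OF assms(1)] by (simp add: m_lcomm)
      then show ?thesis using ideal.I_l_closed[OF IX] * ea by blast
    qed
  qed
  moreover have "(\<lambda>a. c \<otimes> a) ` B \<subseteq> {y. \<exists>b\<in>Idl B. y = c \<otimes> b}"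
    using genideal_self[OF assms(1)] by auto
  ultimately show thesis using Idl_subsetI assms that by blast
qed

text \<open>The ideals generated by finite subsets are directed, so their union is already an ideal.
  The colon computations below induct on a total degree, which calls for finite generating
  sets.\<close>

lemma Idl_finite_subset:
  assumes B: "B \<subseteq> carrier R" and y: "y \<in> Idl B"
  obtains Y where "finite Y" "Y \<subseteq> B" "y \<in> Idl Y"
proof -
  define S where "S = {y. \<exists>Y. finite Y \<and> Y \<subseteq> B \<and> y \<in> Idl Y}"
  have "ideal S R"
  proof (rule ideal_of_closedI)
    show "S \<subseteq> carrier R" proof
      fix v assume "v \<in> S"
      then obtain Y where "Y \<subseteq> B" "v \<in> Idl Y" by (auto simp: S_def)
      then show "v \<in> carrier R" using Idl_carrier[of Y v] B by auto
    qed
    show "\<zero> \<in> S"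
      unfolding S_def using ideal_zero[OF genideal_ideal[of "{}"]] by blast
    show "a \<oplus> b \<in> S" if ab: "a \<in> S" "b \<in> S" for a b
    proof -
      obtain Y Z where *: "finite Y" "Y \<subseteq> B" "a \<in> Idl Y" "finite Z" "Z \<subseteq> B" "b \<in> Idl Z"
        using ab by (auto simp: S_def)
      have "a \<in> Idl (Y \<union> Z)" "b \<in> Idl (Y \<union> Z)"
        using Idl_mono[of Y "Y \<union> Z"] Idl_mono[of Z "Y \<union> Z"] * B by auto
      moreover have "ideal (Idl (Y \<union> Z)) R" using * B by (intro genideal_ideal) auto
      ultimately have "a \<oplus> b \<in> Idl (Y \<union> Z)" by (simp add: ideal_add)
      then show ?thesis unfolding S_def using * by (intro CollectI exI[of _ "Y \<union> Z"]) auto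
    qed
    show "c \<otimes> a \<in> S" if ca: "c \<in> carrier R" "a \<in> S" for c a
    proof -
      obtain Y where *: "finite Y" "Y \<subseteq> B" "a \<in> Idl Y" using ca by (auto simp: S_def)
      then have "c \<otimes> a \<in> Idl Y" using B ca by (intro ideal.I_l_closed genideal_ideal) auto
      then show ?thesis unfolding S_def using * by blast
    qed
  qed
  moreover have "B \<subseteq> S"
  proof
    fix v assume "v \<in> B"
    then show "v \<in> S" unfolding S_def using genideal_self'[of v] B by (intro CollectI exI[of _ "{v}"]) auto
  qed
  ultimately show thesis using Idl_subsetI y that unfolding S_def by blast
qed

lemma minus_add_cancel: "a \<in> carrier R \<Longrightarrow> b \<in> carrier R \<Longrightarrow> (a \<ominus> b) \<oplus> b = a"
  by algebra

lemma add_minus_cancel_comm: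
  "h \<in> carrier R \<Longrightarrow> u \<in> carrier R \<Longrightarrow> m \<in> carrier R \<Longrightarrow> (h \<oplus> u \<otimes> m) \<ominus> h = m \<otimes> u"
  by algebra

lemma mult_minus_of_add_eq:
  assumes c: "k \<in> carrier R" "k' \<in> carrier R" "u \<in> carrier R" "u' \<in> carrier R" "y \<in> carrier R" "m \<in> carrier R"
    and eq: "k \<oplus> u \<otimes> m = k' \<oplus> u' \<otimes> (y \<otimes> m)"
  shows "m \<otimes> (u \<ominus> y \<otimes> u') = k' \<ominus> k"
proof -
  have "m \<otimes> (u \<ominus> y \<otimes> u') = ((k \<oplus> u \<otimes> m) \<ominus> k) \<ominus> u' \<otimes> (y \<otimes> m)" using c by algebra
  also have "\<dots> = k' \<ominus> k" unfolding eq using c by algebra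
  finally show ?thesis .
qed

text \<open>Krull's factor: if \<open>u\<close> is congruent to \<open>y \<otimes> u'\<close> and
  \<open>u'\<close> to \<open>c \<otimes> u\<close> modulo an ideal, then
  \<open>\<one> \<ominus> c \<otimes> y\<close> sends \<open>u'\<close> into that ideal.\<close>

lemma one_minus_mult_eq:
  assumes c: "h \<in> carrier R" "c \<in> carrier R" "u \<in> carrier R" "u' \<in> carrier R" "y \<in> carrier R"
    and eq: "u' = h \<oplus> c \<otimes> u"
  shows "(\<one> \<ominus> c \<otimes> y) \<otimes> u' = h \<oplus> c \<otimes> (u \<ominus> y \<otimes> u')"
proof -
  have "(\<one> \<ominus> c \<otimes> y) \<otimes> u' = u' \<ominus> c \<otimes> (y \<otimes> u')" using c by algebra
  also have "\<dots> = (h \<oplus> c \<otimes> u) \<ominus> c \<otimes> (y \<otimes> u')" by (simp flip: eq)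
  also have "\<dots> = h \<oplus> c \<otimes> (u \<ominus> y \<otimes> u')" using c by algebra
  finally show ?thesis .
qed

end

section \<open>Monomial ideals\<close>

text \<open>These properties make the parameters behave like variables: modulo the prime ideal
  generated by some of them, every other parameter is nonzero and hence a nonzerodivisor. The colon
  computations bottom out at these primes.\<close>

locale monomial_system = noetherian_domain R for R (structure) +
  fixes x :: "nat \<Rightarrow> 'a" and d :: nat
  assumes x_closed: "i < d \<Longrightarrow> x i \<in> carrier R"
    and prime_Idl: "S \<subseteq> {..<d} \<Longrightarrow> primeideal (Idl (x ` S)) R"
    and x_notin: "S \<subseteq> {..<d} \<Longrightarrow> i < d \<Longrightarrow> i \<notin> S \<Longrightarrow> x i \<notin> Idl (x ` S)"
begin

abbreviation mon :: "(nat \<Rightarrow> nat) \<Rightarrow> 'a" where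
  "mon \<equiv> monomial R x d"

abbreviation mon_ideal :: "(nat \<Rightarrow> nat) set \<Rightarrow> 'a set" where
  "mon_ideal G \<equiv> Idl (mon ` G)"

abbreviation param_ideal :: "'a set" where
  "param_ideal \<equiv> Idl (x ` {..<d})"

lemma mon_closed [simp]: "mon e \<in> carrier R"
  unfolding monomial_def by (rule finprod_closed) (auto simp: x_closed)

lemma mon_image_closed [simp]: "mon ` G \<subseteq> carrier R"
  by auto

lemma mon_cong: "(\<And>i. i < d \<Longrightarrow> e i = f i) \<Longrightarrow> mon e = mon f"
  unfolding monomial_def by (rule finprod_cong') (auto simp: x_closed)

lemma mon_add: "mon (\<lambda>i. e i + f i) = mon e \<otimes> mon f"
proof -
  have "mon e \<otimes> mon f = finprod R (\<lambda>i. x i [^] e i \<otimes> x i [^] f i) {..<d}"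
    unfolding monomial_def by (rule finprod_multf[symmetric]) (auto simp: x_closed)
  also have "\<dots> = mon (\<lambda>i. e i + f i)"
    unfolding monomial_def by (rule finprod_cong') (auto simp: x_closed nat_pow_mult)
  finally show ?thesis ..
qed

lemma mon_zero: "(\<And>i. i < d \<Longrightarrow> e i = 0) \<Longrightarrow> mon e = \<one>"
  unfolding monomial_def by (rule finprod_one_eqI) auto

lemma mon_unit:
  assumes "i < d" shows "mon ((\<lambda>_. 0)(i := k)) = x i [^] k"
proof -
  have "mon ((\<lambda>_. 0)(i := k)) = finprod R (\<lambda>j. if i = j then x j [^] k else \<one>) {..<d}"
    unfolding monomial_def by (rule finprod_cong') (auto simp: x_closed)
  also have "\<dots> = x i [^] k"
    using assms by (subst finprod_singleton) (auto simp: x_closed)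
  finally show ?thesis .
qed

lemma mon_Suc:
  assumes "i < d" shows "mon (e(i := Suc (e i))) = x i \<otimes> mon e"
proof -
  have "mon (e(i := Suc (e i))) = mon (\<lambda>j. ((\<lambda>_. 0)(i := 1)) j + e j)"
    by (rule mon_cong) auto
  then show ?thesis unfolding mon_add mon_unit[OF assms] using assms x_closed by simp
qed

lemma mon_le:
  assumes "\<And>i. i < d \<Longrightarrow> e i \<le> f i" shows "mon f = mon (\<lambda>i. f i - e i) \<otimes> mon e"
  unfolding mon_add[symmetric] by (rule mon_cong) (use assms in auto)

lemma mon_ideal_ideal [simp]: "ideal (mon_ideal G) R"
  by (simp add: genideal_ideal)

lemma mon_in_mon_ideal:
  assumes "g \<in> G" "\<And>i. i < d \<Longrightarrow> g i \<le> e i" shows "mon e \<in> mon_ideal G"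
proof -
  have "mon g \<in> mon_ideal G" using assms genideal_self[of "mon ` G"] by auto
  then show ?thesis using mon_le[of g e] assms(2) ideal.I_l_closed[OF mon_ideal_ideal] by simp
qed

lemma mon_ideal_subset:
  assumes "\<And>g. g \<in> G \<Longrightarrow> \<exists>h\<in>H. \<forall>i<d. h i \<le> g i" shows "mon_ideal G \<subseteq> mon_ideal H"
proof (rule Idl_subsetI)
  show "mon ` G \<subseteq> mon_ideal H"
  proof
    fix a assume "a \<in> mon ` G"
    then obtain g where g: "g \<in> G" "a = mon g" by auto
    with assms obtain h where "h \<in> H" "\<forall>i<d. h i \<le> g i" by blast
    with g show "a \<in> mon_ideal H" using mon_in_mon_ideal[of h H g] by simp
  qed
qed simp

lemma mon_ideal_mono: "G \<subseteq> H \<Longrightarrow> mon_ideal G \<subseteq> mon_ideal H"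
  by (rule mon_ideal_subset) auto

lemma mon_ideal_carrier: "y \<in> mon_ideal G \<Longrightarrow> y \<in> carrier R"
  by (rule Idl_carrier) auto

lemma mon_ideal_finite_subset:
  assumes "y \<in> mon_ideal G" obtains H where "finite H" "H \<subseteq> G" "y \<in> mon_ideal H"
proof -
  obtain Y where Y: "finite Y" "Y \<subseteq> mon ` G" "y \<in> Idl Y"
    using Idl_finite_subset[OF _ assms] by auto
  then obtain H where "H \<subseteq> G" "finite H" "Y = mon ` H" by (meson finite_subset_image)
  then show thesis using that Y by auto
qed

lemma mon_ideal_one:
  assumes "g \<in> G" "\<And>i. i < d \<Longrightarrow> g i = 0" "u \<in> carrier R" shows "u \<in> mon_ideal G"
proof -
  have "\<one> \<in> mon_ideal G" using mon_in_mon_ideal[OF assms(1), of "\<lambda>_. 0"] assms(2) mon_zero by simp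
  then show ?thesis using assms(3) ideal.I_l_closed[OF mon_ideal_ideal, of \<one> G u] by simp
qed

lemma mon_ideal_Un_decomp:
  assumes "z \<in> mon_ideal (G \<union> H)"
  obtains a b where "a \<in> mon_ideal G" "b \<in> mon_ideal H" "z = a \<oplus> b"
  using Idl_Un_decomp[of "mon ` G" "mon ` H" z] assms by (auto simp: image_Un)

lemma mon_ideal_insert_decomp:
  assumes "z \<in> mon_ideal (insert e G)"
  obtains k c where "k \<in> mon_ideal G" "c \<in> carrier R" "z = k \<oplus> c \<otimes> mon e"
  using Idl_insert_decomp[of "mon ` G" "mon e" z] assms by auto

section \<open>Colon ideals by a parameter and by elements outside the parameter ideal\<close>

definition dec :: "nat \<Rightarrow> (nat \<Rightarrow> nat) \<Rightarrow> nat \<Rightarrow> nat" where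
  "dec i g = g(i := g i - 1)"

definition deg :: "(nat \<Rightarrow> nat) \<Rightarrow> nat" where
  "deg g = (\<Sum>i<d. g i)"

lemma deg_dec_le: "deg (dec i g) \<le> deg g"
  unfolding deg_def dec_def by (rule sum_mono) auto

lemma deg_dec_less: "i < d \<Longrightarrow> 0 < g i \<Longrightarrow> deg (dec i g) < deg g"
  unfolding deg_def dec_def by (rule sum_strict_mono_ex1) auto

lemma deg_eq_0_iff: "deg g = 0 \<longleftrightarrow> (\<forall>i<d. g i = 0)"
  by (auto simp: deg_def)

lemma deg_eq_1:
  assumes "deg g = 1" obtains s where "s < d" "\<And>i. i < d \<Longrightarrow> g i = (if i = s then 1 else 0)"
proof -
  have "\<exists>s\<in>{..<d}. g s = 1 \<and> (\<forall>b\<in>{..<d}. s \<noteq> b \<longrightarrow> g b = 0)"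
    using assms unfolding deg_def by (subst (asm) sum_eq_1_iff) auto
  then obtain s where "s < d" "g s = 1" "\<And>b. b < d \<Longrightarrow> b \<noteq> s \<Longrightarrow> g b = 0" by auto
  then show thesis using that[of s] by auto
qed

text \<open>Subtraction truncates, so \<open>dec i\<close> divides a monomial by \<open>x i\<close>
  where possible and otherwise leaves it alone. The decremented exponents should therefore generate
  the colon ideal by \<open>x i\<close>. This is the easy inclusion; \<open>colon_x\<close> is the
  hard one.\<close>

lemma x_mult_dec:
  assumes "i < d" "v \<in> mon_ideal (dec i ` G)" shows "x i \<otimes> v \<in> mon_ideal G"
proof (rule mult_Idl_subset[OF _ _ _ _ assms(2)])
  fix a assume "a \<in> mon ` dec i ` G"
  then obtain g where g: "g \<in> G" "a = mon (dec i g)" by auto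
  have "x i \<otimes> a = mon ((dec i g)(i := Suc (dec i g i)))"
    using mon_Suc[OF assms(1), of "dec i g"] g by simp
  then show "x i \<otimes> a \<in> mon_ideal G"
    by (auto simp: dec_def intro!: mon_in_mon_ideal[OF g(1)])
qed (auto simp: x_closed assms)

lemma mon_ideal_dec_subset: "mon_ideal G \<subseteq> mon_ideal (dec i ` G)"
proof (rule mon_ideal_subset)
  fix g assume "g \<in> G"
  then show "\<exists>h\<in>dec i ` G. \<forall>j<d. h j \<le> g j"
    by (intro bexI[of _ "dec i g"]) (auto simp: dec_def)
qed

text \<open>Generators of degree one are parameters themselves, which brings the base case of the
  inductions within reach of \<open>prime_Idl\<close>.\<close>

lemma mon_ideal_linear:
  assumes "\<And>g. g \<in> G \<Longrightarrow> deg g = 1"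
  obtains S where "S \<subseteq> {..<d}" "mon_ideal G = Idl (x ` S)"
    "\<And>i. i \<in> S \<Longrightarrow> \<exists>g\<in>G. \<forall>j<d. g j = (if j = i then 1 else 0)"
proof -
  define S where "S = {i. i < d \<and> (\<exists>g\<in>G. \<forall>j<d. g j = (if j = i then 1 else 0))}"
  have eq: "mon g = x s" if "s < d" "\<forall>j<d. g j = (if j = s then 1 else 0)" for g s
  proof -
    have "mon g = mon ((\<lambda>_. 0)(s := 1))" by (rule mon_cong) (use that in auto)
    then show ?thesis using mon_unit[OF that(1)] x_closed that by simp
  qed
  have "mon ` G = x ` S"
  proof (intro equalityI subsetI)
    fix a assume "a \<in> mon ` G"
    then obtain g where g: "g \<in> G" "a = mon g" by auto
    obtain s where s: "s < d" "\<And>i. i < d \<Longrightarrow> g i = (if i = s then 1 else 0)"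
      using deg_eq_1 assms g by blast
    then show "a \<in> x ` S" using eq[of s g] g unfolding S_def by blast
  next
    fix a assume "a \<in> x ` S"
    then obtain s g where "s < d" "a = x s" "g \<in> G" "\<forall>j<d. g j = (if j = s then 1 else 0)"
      unfolding S_def by blast
    then show "a \<in> mon ` G" using eq[of s g] by (intro image_eqI[of _ _ g]) simp_all
  qed
  then show thesis by (intro that[of S]) (simp_all add: S_def subset_iff)
qed

text \<open>Adding \<open>x j\<close> to the ideal makes all generators divisible by it redundant.
  The total degree drops once one of these has degree at least two, since the new generator
  contributes at most one.\<close>

lemma sum_deg_insert_linear:
  assumes "finite G" "g \<in> G" "g j \<noteq> 0" "2 \<le> deg g"
  shows "sum deg (insert ((\<lambda>_. 0)(j := 1)) {g \<in> G. g j = 0}) < sum deg G"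
proof -
  let ?G0 = "{g \<in> G. g j = 0}"
  have "deg ((\<lambda>_. 0)(j := 1)) \<le> 1" by (simp add: deg_def)
  then have "sum deg (insert ((\<lambda>_. 0)(j := 1)) ?G0) \<le> 1 + sum deg ?G0"
    using assms(1) by (subst sum.insert_if) auto
  also have "\<dots> < deg g + sum deg ?G0" using assms by simp
  also have "\<dots> = sum deg (insert g ?G0)" using assms by simp
  also have "\<dots> \<le> sum deg G" using assms by (intro sum_mono2) auto
  finally show ?thesis .
qed

lemma sum_deg_filter:
  assumes "finite G" "g \<in> G" "j < d" "g j \<noteq> 0"
  shows "sum deg {g \<in> G. g j = 0} < sum deg G"
proof (rule sum_strict_mono2)
  show "0 < deg g" using assms deg_eq_0_iff[of g] by auto
qed (use assms in auto)

lemma sum_deg_dec: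
  assumes "finite G" "g \<in> G" "j < d" "g j \<noteq> 0"
  shows "sum deg (dec j ` G) < sum deg G"
proof -
  have "sum deg (dec j ` G) \<le> (\<Sum>g\<in>G. deg (dec j g))"
    using sum_image_le[OF assms(1), of deg "dec j"] by simp
  also have "\<dots> < sum deg G"
    using assms by (intro sum_strict_mono_ex1) (auto intro: deg_dec_le deg_dec_less)
  finally show ?thesis .
qed

lemma mon_ideal_split:
  assumes "j < d" "z \<in> mon_ideal G"
  obtains a b where "a \<in> mon_ideal {g \<in> G. g j = 0}" "b \<in> mon_ideal (dec j ` G)" "z = a \<oplus> x j \<otimes> b"
proof -
  let ?G0 = "{g \<in> G. g j = 0}" and ?G1 = "{g \<in> G. g j \<noteq> 0}"
  have "?G0 \<union> ?G1 = G" by auto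
  with assms(2) have "z \<in> mon_ideal (?G0 \<union> ?G1)" by simp
  then obtain a c where ac: "a \<in> mon_ideal ?G0" "c \<in> mon_ideal ?G1" "z = a \<oplus> c"
    by (rule mon_ideal_Un_decomp)
  have "mon g = x j \<otimes> mon (dec j g)" if "g \<in> ?G1" for g
    using mon_Suc[OF assms(1), of "dec j g"] that by (simp add: dec_def)
  then have "mon ` ?G1 = (\<lambda>a. x j \<otimes> a) ` (mon ` dec j ` ?G1)"
    unfolding image_image by (rule image_cong[OF refl])
  with ac(2) have "c \<in> Idl ((\<lambda>a. x j \<otimes> a) ` (mon ` dec j ` ?G1))" by (rule subst[rotated])
  then obtain b where "b \<in> mon_ideal (dec j ` ?G1)" "c = x j \<otimes> b"
    by (rule Idl_mult_image[OF mon_image_closed x_closed[OF assms(1)]])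
  moreover have "mon_ideal (dec j ` ?G1) \<subseteq> mon_ideal (dec j ` G)" by (rule mon_ideal_mono) auto
  ultimately show thesis using that ac by auto
qed

lemma mon_ideal_insert_x:
  assumes j: "j < d" and z: "z \<in> mon_ideal G"
  shows "z \<in> mon_ideal (insert ((\<lambda>_. 0)(j := 1)) {g \<in> G. g j = 0})" (is "z \<in> mon_ideal ?H")
proof -
  have "mon_ideal G \<subseteq> mon_ideal ?H"
  proof (rule mon_ideal_subset)
    fix g assume "g \<in> G"
    then show "\<exists>h\<in>?H. \<forall>i<d. h i \<le> g i" by (cases "g j = 0") auto
  qed
  then show ?thesis using z by auto
qed

lemma mon_ideal_insert_x_decomp:
  assumes "j < d" "z \<in> mon_ideal (insert ((\<lambda>_. 0)(j := 1)) G)"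
  obtains k c where "k \<in> mon_ideal G" "c \<in> carrier R" "z = k \<oplus> x j \<otimes> c"
proof -
  obtain k c where "k \<in> mon_ideal G" "c \<in> carrier R" "z = k \<oplus> c \<otimes> mon ((\<lambda>_. 0)(j := 1))"
    by (rule mon_ideal_insert_decomp[OF assms(2)])
  then show thesis
    using that[of k c] mon_unit[OF assms(1), of 1] x_closed[OF assms(1)] by (simp add: m_comm)
qed

text \<open>Induction on the total degree of the generators. A generator of degree zero gives the
  unit ideal, and generators all of degree one give a prime ideal. Otherwise some \<open>x j\<close>
  divides a generator of degree at least two, and both the sum with \<open>x j\<close> and the colon
  by \<open>x j\<close> have smaller total degree.\<close>

lemma colon_x:
  assumes "finite G" "i < d" "u \<in> carrier R" "x i \<otimes> u \<in> mon_ideal G"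
  shows "u \<in> mon_ideal (dec i ` G)"
  using assms
proof (induction "sum deg G" arbitrary: G i u rule: less_induct)
  case less
  note xc = x_closed
  consider (zero) g where "g \<in> G" "deg g = 0" | (lin) "\<forall>g\<in>G. deg g = 1" | (big) g where "g \<in> G" "2 \<le> deg g"
    by (metis One_nat_def less_2_cases_iff not_le)
  then show ?case
  proof cases
    case zero
    then show ?thesis using mon_ideal_one[of g G u] mon_ideal_dec_subset less.prems by (auto simp: deg_eq_0_iff)
  next
    case lin
    then obtain S where S: "S \<subseteq> {..<d}" "mon_ideal G = Idl (x ` S)"
      "\<And>i. i \<in> S \<Longrightarrow> \<exists>g\<in>G. \<forall>j<d. g j = (if j = i then 1 else 0)"
      using mon_ideal_linear[of G] by auto
    show ?thesis
    proof (cases "i \<in> S")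
      case True
      then obtain g where "g \<in> G" "\<forall>j<d. g j = (if j = i then 1 else 0)" using S by blast
      then show ?thesis using less.prems by (intro mon_ideal_one[of "dec i g" "dec i ` G"] imageI) (simp_all add: dec_def)
    next
      case False
      then have "u \<in> mon_ideal G"
        using primeideal.I_prime[OF prime_Idl[OF S(1)], of "x i" u] x_notin[OF S(1)] less.prems xc S by auto
      then show ?thesis using mon_ideal_dec_subset by auto
    qed
  next
    case big
    then obtain j where j: "j < d" "g j \<noteq> 0" using deg_eq_0_iff[of g] by auto
    let ?G0 = "{g \<in> G. g j = 0}"
    \<comment> \<open>The colon by \<open>x j\<close> itself comes first, since the case
      \<open>i \<noteq> j\<close> relies on it. Generators divisible by \<open>x j\<close>
      contribute a multiple \<open>x j \<otimes> b\<close>; subtracting it leaves a problem with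
      fewer generators.\<close>
    have colon_j: "v \<in> mon_ideal (dec j ` G)" if v: "v \<in> carrier R" "x j \<otimes> v \<in> mon_ideal G" for v
    proof -
      obtain a b where ab: "a \<in> mon_ideal ?G0" "b \<in> mon_ideal (dec j ` G)" "x j \<otimes> v = a \<oplus> x j \<otimes> b"
        by (rule mon_ideal_split[OF j(1) v(2)])
      have c: "a \<in> carrier R" "b \<in> carrier R" using mon_ideal_carrier[OF ab(1)] mon_ideal_carrier[OF ab(2)] by simp_all
      have "x j \<otimes> (v \<ominus> b) = x j \<otimes> v \<ominus> x j \<otimes> b"
        using c v xc[OF j(1)] by algebra
      also have "\<dots> = a" unfolding ab(3) using c v xc[OF j(1)] by algebra
      finally have "x j \<otimes> (v \<ominus> b) \<in> mon_ideal ?G0" using ab by simp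
      moreover have "sum deg ?G0 < sum deg G"
        using sum_deg_filter[OF less.prems(1) big(1) j] .
      ultimately have "v \<ominus> b \<in> mon_ideal (dec j ` ?G0)"
        using less.hyps[of ?G0 j] less.prems(1) j v c by auto
      moreover have "mon_ideal (dec j ` ?G0) \<subseteq> mon_ideal (dec j ` G)" by (rule mon_ideal_mono) auto
      ultimately have "(v \<ominus> b) \<oplus> b \<in> mon_ideal (dec j ` G)" using ab ideal_add[OF mon_ideal_ideal] by blast
      moreover have "(v \<ominus> b) \<oplus> b = v" using v c by algebra
      ultimately show ?thesis by simp
    qed
    show ?thesis
    proof (cases "i = j")
      case True then show ?thesis using colon_j less.prems by auto
    next
      case False
      let ?e = "(\<lambda>_. 0)(j := 1) :: nat \<Rightarrow> nat"
      \<comment> \<open>Modulo \<open>x j\<close> the problem is smaller; it determines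
        \<open>u\<close> up to a multiple \<open>x j \<otimes> c\<close>.\<close>
      have "x i \<otimes> u \<in> mon_ideal (insert ?e ?G0)" by (rule mon_ideal_insert_x[OF j(1) less.prems(4)])
      then have "u \<in> mon_ideal (dec i ` insert ?e ?G0)"
        using less.hyps[of "insert ?e ?G0" i u] sum_deg_insert_linear[of G g j] less.prems big j by auto
      moreover have "dec i ?e = ?e" using False by (auto simp: dec_def)
      ultimately obtain k c where kc: "k \<in> mon_ideal (dec i ` ?G0)" "c \<in> carrier R" "u = k \<oplus> x j \<otimes> c"
        using mon_ideal_insert_x_decomp[OF j(1), of u "dec i ` ?G0"] by auto
      have k: "k \<in> mon_ideal (dec i ` G)" using kc(1) mon_ideal_mono[of "dec i ` ?G0" "dec i ` G"] by blast
      have kcarr: "k \<in> carrier R" by (rule mon_ideal_carrier[OF kc(1)])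
      have "x i \<otimes> u \<ominus> x i \<otimes> k \<in> mon_ideal G"
        using x_mult_dec[OF less.prems(2) k] less.prems ideal_minus by auto
      moreover have "x i \<otimes> u \<ominus> x i \<otimes> k = x j \<otimes> (x i \<otimes> c)"
        unfolding kc(3) using kc kcarr xc[OF j(1)] xc[OF less.prems(2)] by algebra
      \<comment> \<open>The remaining coefficient \<open>c\<close> is caught in the colon by
        \<open>x j\<close>, whose generators have smaller total degree.\<close>
      ultimately have "x i \<otimes> c \<in> mon_ideal (dec j ` G)"
        using colon_j[of "x i \<otimes> c"] kc xc[OF less.prems(2)] by auto
      then have "c \<in> mon_ideal (dec i ` dec j ` G)"
        using less.hyps[of "dec j ` G" i c] sum_deg_dec[of G g j] less.prems big j kc by auto
      moreover have "dec i ` dec j ` G = dec j ` dec i ` G"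
        using False by (auto simp: image_image dec_def fun_upd_twist)
      ultimately have "x j \<otimes> c \<in> mon_ideal (dec i ` G)" using x_mult_dec[OF j(1)] by auto
      then show ?thesis unfolding kc(3) using k ideal_add by auto
    qed
  qed
qed

text \<open>An element outside \<open>param_ideal\<close> avoids every prime generated by a subset
  of the parameters, which settles generators of degree one. The inductive step is that of
  \<open>colon_x\<close>: first modulo \<open>x j\<close>, then in the colon by \<open>x j\<close>.
  This replaces localization at \<open>param_ideal\<close>.\<close>

lemma nonzerodivisor_mod_mon_ideal:
  assumes "finite G" "y \<in> carrier R" "y \<notin> param_ideal" "u \<in> carrier R" "y \<otimes> u \<in> mon_ideal G"
  shows "u \<in> mon_ideal G"
  using assms(1,4,5)
proof (induction "sum deg G" arbitrary: G u rule: less_induct)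
  case less
  note xc = x_closed
  consider (zero) g where "g \<in> G" "deg g = 0" | (lin) "\<forall>g\<in>G. deg g = 1" | (big) g where "g \<in> G" "2 \<le> deg g"
    by (metis One_nat_def less_2_cases_iff not_le)
  then show ?case
  proof cases
    case zero
    then show ?thesis using mon_ideal_one[of g G u] less.prems by (auto simp: deg_eq_0_iff)
  next
    case lin
    then obtain S where S: "S \<subseteq> {..<d}" "mon_ideal G = Idl (x ` S)"
      using mon_ideal_linear[of G] by metis
    have "y \<notin> Idl (x ` S)"
      using Idl_mono[of "x ` S" "x ` {..<d}"] S xc assms(3) by blast
    then show ?thesis
      using primeideal.I_prime[OF prime_Idl[OF S(1)], of y u] less.prems assms S by auto
  next
    case big
    then obtain j where j: "j < d" "g j \<noteq> 0" using deg_eq_0_iff[of g] by auto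
    let ?G0 = "{g \<in> G. g j = 0}"
    let ?e = "(\<lambda>_. 0)(j := 1) :: nat \<Rightarrow> nat"
    have "y \<otimes> u \<in> mon_ideal (insert ?e ?G0)" by (rule mon_ideal_insert_x[OF j(1) less.prems(3)])
    then have "u \<in> mon_ideal (insert ?e ?G0)"
      using less.hyps[of "insert ?e ?G0" u] sum_deg_insert_linear[of G g j] less.prems big j by auto
    then obtain k c where kc: "k \<in> mon_ideal ?G0" "c \<in> carrier R" "u = k \<oplus> x j \<otimes> c"
      using mon_ideal_insert_x_decomp[OF j(1), of u ?G0] by auto
    have k: "k \<in> mon_ideal G" using kc(1) mon_ideal_mono[of ?G0 G] by blast
    have kcarr: "k \<in> carrier R" by (rule mon_ideal_carrier[OF kc(1)])
    have "y \<otimes> u \<ominus> y \<otimes> k \<in> mon_ideal G"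
      using ideal.I_l_closed[OF mon_ideal_ideal k assms(2)] less.prems ideal_minus by auto
    moreover have "y \<otimes> u \<ominus> y \<otimes> k = x j \<otimes> (y \<otimes> c)"
      unfolding kc(3) using kc kcarr xc[OF j(1)] assms(2) by algebra
    ultimately have "y \<otimes> c \<in> mon_ideal (dec j ` G)"
      using colon_x[of G j "y \<otimes> c"] kc assms less.prems j by auto
    then have "c \<in> mon_ideal (dec j ` G)"
      using less.hyps[of "dec j ` G" c] sum_deg_dec[of G g j] less.prems big j kc by auto
    then have "x j \<otimes> c \<in> mon_ideal G" using x_mult_dec[OF j(1)] by auto
    then show ?thesis unfolding kc(3) using k ideal_add by auto
  qed
qed

section \<open>Colons by monomials and coefficients modulo the parameter ideal\<close>

lemma mon_dec:
  assumes "i < d" "0 < e i" shows "mon e = x i \<otimes> mon (dec i e)"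
  using mon_Suc[OF assms(1), of "dec i e"] assms(2) by (simp add: dec_def)

lemma param_ideal_ideal [simp]: "ideal param_ideal R"
  using x_closed by (intro genideal_ideal) auto

lemma one_notin_param_ideal: "\<one> \<notin> param_ideal"
  using primeideal.I_notcarr[OF prime_Idl[of "{..<d}"]] ideal.one_imp_carrier[OF param_ideal_ideal] by auto

lemma x_in_param_ideal: "i < d \<Longrightarrow> x i \<in> param_ideal"
  using genideal_self[of "x ` {..<d}"] x_closed by blast

lemma mon_in_param_ideal:
  assumes "i < d" "0 < e i" shows "mon e \<in> param_ideal"
  unfolding mon_dec[of i e, OF assms]
  using ideal.I_r_closed[OF param_ideal_ideal x_in_param_ideal[OF assms(1)]] by simp

lemma colon_mon:
  assumes "finite G" "u \<in> carrier R" "mon f \<otimes> u \<in> mon_ideal G"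
  shows "u \<in> mon_ideal ((\<lambda>g i. g i - f i) ` G)"
  using assms
proof (induction "deg f" arbitrary: f G)
  case 0
  then have "mon f = \<one>" by (intro mon_zero) (simp add: deg_eq_0_iff)
  then have "u \<in> mon_ideal G" using 0 by simp
  moreover have "mon_ideal G \<subseteq> mon_ideal ((\<lambda>g i. g i - f i) ` G)"
    by (rule mon_ideal_subset) force
  ultimately show ?case by blast
next
  case (Suc n)
  have "\<not> (\<forall>i<d. f i = 0)" using Suc.hyps(2) deg_eq_0_iff[of f] by simp
  then obtain i where i: "i < d" "0 < f i" by blast
  have "deg (f(i := f i - 1)) + 1 = deg f"
    using i by (simp add: deg_def sum.remove[of "{..<d}" i] cong: sum.cong_simp)
  then have n: "n = deg (dec i f)" using Suc.hyps(2) by (simp add: dec_def)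
  have "x i \<otimes> (mon (dec i f) \<otimes> u) \<in> mon_ideal G"
    using Suc.prems mon_dec[of i f] i x_closed by (simp add: m_assoc)
  then have "mon (dec i f) \<otimes> u \<in> mon_ideal (dec i ` G)"
    using Suc.prems i by (intro colon_x) auto
  then have "u \<in> mon_ideal ((\<lambda>g j. g j - dec i f j) ` dec i ` G)"
    using Suc.prems by (intro Suc.hyps(1)[OF n]) auto
  \<comment> \<open>At \<open>i\<close> both exponents lose one before the subtraction, which is
    harmless under truncation because \<open>f i\<close> is positive.\<close>
  moreover have "(\<lambda>j. dec i g j - dec i f j) = (\<lambda>j. g j - f j)" for g
    using i by (auto simp: dec_def fun_eq_iff)
  ultimately show ?case by (simp add: image_image)
qed

text \<open>After division by \<open>mon f\<close> every generator keeps a positive exponent and so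
  lies in \<open>param_ideal\<close>. This is how coefficients are read off modulo
  \<open>param_ideal\<close>.\<close>

lemma mon_coeff_in_param_ideal:
  assumes G: "\<And>g. g \<in> G \<Longrightarrow> \<exists>i<d. f i < g i"
    and u: "u \<in> carrier R" "mon f \<otimes> u \<in> mon_ideal G"
  shows "u \<in> param_ideal"
proof -
  obtain H where H: "finite H" "H \<subseteq> G" "mon f \<otimes> u \<in> mon_ideal H"
    by (rule mon_ideal_finite_subset[OF u(2)])
  have "u \<in> mon_ideal ((\<lambda>g i. g i - f i) ` H)" by (rule colon_mon[OF H(1) u(1) H(3)])
  moreover have "mon_ideal ((\<lambda>g i. g i - f i) ` H) \<subseteq> param_ideal"
  proof (rule Idl_subsetI)
    show "mon ` (\<lambda>g i. g i - f i) ` H \<subseteq> param_ideal"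
    proof
      fix a assume "a \<in> mon ` (\<lambda>g i. g i - f i) ` H"
      then obtain g where g: "g \<in> H" "a = mon (\<lambda>i. g i - f i)" by blast
      then obtain i where "i < d" "f i < g i" using G H by blast
      then show "a \<in> param_ideal" unfolding g(2) by (intro mon_in_param_ideal[of i]) auto
    qed
  qed simp
  ultimately show ?thesis by blast
qed

lemma mon_notin_mon_ideal:
  assumes "\<And>g. g \<in> G \<Longrightarrow> \<exists>i<d. f i < g i" shows "mon f \<notin> mon_ideal G"
  using mon_coeff_in_param_ideal[of G f \<one>] one_notin_param_ideal assms by auto

section \<open>Krull intersection and irreducible monomial ideals\<close>

lemma Inter_add_x_power:
  assumes fin: "finite G" and i: "i < d"
    and r: "\<And>N. r \<in> mon_ideal (insert ((\<lambda>_. 0)(i := N)) G)"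
  shows "r \<in> mon_ideal G"
proof -
  let ?e = "\<lambda>N. (\<lambda>_. 0)(i := N) :: nat \<Rightarrow> nat"
  have "\<exists>k u. k \<in> mon_ideal G \<and> u \<in> carrier R \<and> r = k \<oplus> u \<otimes> mon (?e N)" for N
    using mon_ideal_insert_decomp[OF r[of N]] by metis
  then obtain k u where ku: "\<And>N. k N \<in> mon_ideal G" "\<And>N. u N \<in> carrier R"
      "\<And>N. r = k N \<oplus> u N \<otimes> mon (?e N)"
    by metis
  have kc: "k N \<in> carrier R" for N by (rule mon_ideal_carrier[OF ku(1)])
  have xi: "x i \<in> carrier R" using x_closed i by simp
  \<comment> \<open>From \<open>N0\<close> on, the colon of \<open>mon_ideal G\<close> by the
    \<open>N\<close>-th power of \<open>x i\<close> is independent of \<open>N\<close>: it is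
    generated by the exponents in \<open>H\<close>, where \<open>x i\<close> is set to one. A sum in
    place of a maximum also covers empty \<open>G\<close>.\<close>
  define N0 where "N0 = (\<Sum>g\<in>G. g i)"
  have N0: "g i \<le> N0" if "g \<in> G" for g
    unfolding N0_def using member_le_sum[OF that, of "\<lambda>g. g i"] fin by simp
  define H where "H = (\<lambda>g. g(i := 0)) ` G"
  have Hfin: "finite H" by (simp add: H_def fin)
  \<comment> \<open>Comparing the expansions of \<open>r\<close> at \<open>N\<close> and
    \<open>Suc N\<close> and cancelling the common power of \<open>x i\<close> makes
    \<open>u N\<close> a multiple of \<open>u (Suc N)\<close> modulo
    \<open>mon_ideal H\<close>.\<close>
  have step: "u N \<ominus> x i \<otimes> u (Suc N) \<in> mon_ideal H" if N: "N0 \<le> N" for N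
  proof -
    let ?m = "mon (?e N)"
    have "mon (?e (Suc N)) = x i \<otimes> ?m" using mon_Suc[OF i, of "?e N"] by simp
    then have "k N \<oplus> u N \<otimes> ?m = k (Suc N) \<oplus> u (Suc N) \<otimes> (x i \<otimes> ?m)"
      using ku(3)[of N] ku(3)[of "Suc N"] by simp
    then have "?m \<otimes> (u N \<ominus> x i \<otimes> u (Suc N)) = k (Suc N) \<ominus> k N"
      by (intro mult_minus_of_add_eq kc ku(2) xi mon_closed)
    then have "?m \<otimes> (u N \<ominus> x i \<otimes> u (Suc N)) \<in> mon_ideal G" using ku(1) ideal_minus[OF mon_ideal_ideal] by simp
    then have "u N \<ominus> x i \<otimes> u (Suc N) \<in> mon_ideal ((\<lambda>g j. g j - ?e N j) ` G)"
      using ku(2) xi by (intro colon_mon[OF fin, where f = "?e N"]) simp_all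
    moreover have "(\<lambda>g j. g j - ?e N j) ` G = H"
      unfolding H_def by (rule image_cong[OF refl]) (use N0 N in \<open>fastforce simp: fun_eq_iff\<close>)
    ultimately show ?thesis by simp
  qed
  \<comment> \<open>By \<open>step\<close> these ideals increase, so the chain condition stops them.
    Stability is the reverse relation, which expresses \<open>u (Suc M)\<close> through
    \<open>u M\<close>.\<close>
  define J where "J n = Idl (insert (u (N0 + n)) (mon ` H))" for n
  have gens: "insert (u n) (mon ` H) \<subseteq> carrier R" for n using ku(2) by auto
  have J_ideal: "ideal (J n) R" for n unfolding J_def by (rule genideal_ideal[OF gens])
  have H_J: "mon_ideal H \<subseteq> J n" for n
    unfolding J_def by (rule Idl_mono) (use ku(2) in auto)
  have u_J: "u (N0 + n) \<in> J n" for n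
    unfolding J_def using genideal_self[OF gens] by blast
  have J_Suc: "J n \<subseteq> J (Suc n)" for n
  proof -
    have "u (N0 + n) \<ominus> x i \<otimes> u (Suc (N0 + n)) \<in> J (Suc n)" using step[of "N0 + n"] H_J by auto
    moreover have "x i \<otimes> u (Suc (N0 + n)) \<in> J (Suc n)"
      using ideal.I_l_closed[OF J_ideal u_J[of "Suc n"] xi] by simp
    ultimately have "(u (N0 + n) \<ominus> x i \<otimes> u (Suc (N0 + n))) \<oplus> x i \<otimes> u (Suc (N0 + n)) \<in> J (Suc n)"
      by (rule ideal_add[OF J_ideal])
    moreover have "(u (N0 + n) \<ominus> x i \<otimes> u (Suc (N0 + n))) \<oplus> x i \<otimes> u (Suc (N0 + n)) = u (N0 + n)"
      using ku(2) xi by (simp add: minus_add_cancel)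
    ultimately have "u (N0 + n) \<in> J (Suc n)" by simp
    moreover have "mon ` H \<subseteq> J (Suc n)" using H_J[of "Suc n"] genideal_self[of "mon ` H"] by auto
    ultimately show ?thesis
      unfolding J_def[of n] by (intro Idl_subsetI[OF J_ideal]) auto
  qed
  have "J m \<subseteq> J n" if "m \<le> n" for m n using lift_Suc_mono_le[of J, OF J_Suc that] .
  then have "J m \<subseteq> J n \<or> J n \<subseteq> J m" for m n by (meson nat_le_linear)
  then have "subset.chain {I. ideal I R} (range J)"
    unfolding subset_chain_def using J_ideal by auto
  then obtain n where n: "\<Union> (range J) = J n" using ideal_chain_is_trivial[of "range J"] by auto
  define M where "M = N0 + n"
  have "u (Suc M) \<in> J n" using u_J[of "Suc n"] n unfolding M_def by auto
  then obtain h c where hc: "h \<in> mon_ideal H" "c \<in> carrier R" "u (Suc M) = h \<oplus> c \<otimes> u M"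
    unfolding J_def M_def[symmetric] by (rule Idl_insert_decomp[OF mon_image_closed ku(2)])
  define h' where "h' = u M \<ominus> x i \<otimes> u (Suc M)"
  have h': "h' \<in> mon_ideal H" unfolding h'_def by (rule step) (simp add: M_def)
  have cc: "h \<in> carrier R" by (rule mon_ideal_carrier[OF hc(1)])
  have hh: "(\<one> \<ominus> c \<otimes> x i) \<otimes> u (Suc M) = h \<oplus> c \<otimes> h'"
    unfolding h'_def by (rule one_minus_mult_eq[OF cc hc(2) ku(2) ku(2) xi hc(3)])
  \<comment> \<open>This factor need not be a unit, but it is congruent to one modulo
    \<open>param_ideal\<close> and can be cancelled modulo \<open>mon_ideal H\<close>.\<close>
  have nin: "\<one> \<ominus> c \<otimes> x i \<notin> param_ideal"
  proof
    assume "\<one> \<ominus> c \<otimes> x i \<in> param_ideal"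
    moreover have "c \<otimes> x i \<in> param_ideal"
      using ideal.I_l_closed[OF param_ideal_ideal x_in_param_ideal[OF i] hc(2)] .
    ultimately have "(\<one> \<ominus> c \<otimes> x i) \<oplus> c \<otimes> x i \<in> param_ideal" by (rule ideal_add[OF param_ideal_ideal])
    moreover have "(\<one> \<ominus> c \<otimes> x i) \<oplus> c \<otimes> x i = \<one>" using hc(2) xi by (simp add: minus_add_cancel)
    ultimately show False using one_notin_param_ideal by simp
  qed
  have mem: "(\<one> \<ominus> c \<otimes> x i) \<otimes> u (Suc M) \<in> mon_ideal H"
    unfolding hh using ideal_add[OF mon_ideal_ideal hc(1)] ideal.I_l_closed[OF mon_ideal_ideal h' hc(2)] by simp
  have "\<one> \<ominus> c \<otimes> x i \<in> carrier R" using hc(2) xi by simp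
  then have u_H: "u (Suc M) \<in> mon_ideal H"
    by (rule nonzerodivisor_mod_mon_ideal[OF Hfin _ nin ku(2) mem])
  have "mon (?e (Suc M)) \<otimes> u (Suc M) \<in> mon_ideal G"
  proof (rule mult_Idl_subset[OF _ _ _ _ u_H])
    fix a assume "a \<in> mon ` H"
    then obtain g where g: "g \<in> G" "a = mon (g(i := 0))" unfolding H_def by auto
    have "mon (?e (Suc M)) \<otimes> a = mon (\<lambda>j. ?e (Suc M) j + (g(i := 0)) j)" unfolding g(2) mon_add ..
    moreover have "g i \<le> Suc M" using N0[OF g(1)] unfolding M_def by simp
    ultimately show "mon (?e (Suc M)) \<otimes> a \<in> mon_ideal G" using mon_in_mon_ideal[OF g(1)] by simp
  qed auto
  then have "u (Suc M) \<otimes> mon (?e (Suc M)) \<in> mon_ideal G" using ku(2) by (simp add: m_comm)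
  then show ?thesis using ku(3)[of "Suc M"] ideal_add[OF mon_ideal_ideal ku(1)] by metis
qed

text \<open>\<open>Inter_add_x_power\<close> is used once per parameter, with the powers adjoined
  earlier already in the ideal. The decomposition below needs a pure power of every parameter in
  order to end at some \<open>b\<close>.\<close>

lemma add_x_powers:
  assumes "finite G" "r \<notin> mon_ideal G"
  shows "\<exists>H. finite H \<and> G \<subseteq> H \<and> r \<notin> mon_ideal H \<and> (\<forall>i<d. \<exists>k. (\<lambda>_. 0)(i := k) \<in> H)"
proof -
  have "\<exists>H. finite H \<and> G \<subseteq> H \<and> r \<notin> mon_ideal H \<and> (\<forall>i<n. \<exists>k. (\<lambda>_. 0)(i := k) \<in> H)" if "n \<le> d" for n
    using that
  proof (induction n)
    case 0 then show ?case using assms by auto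
  next
    case (Suc n)
    then obtain H where H: "finite H" "G \<subseteq> H" "r \<notin> mon_ideal H" "\<And>i. i < n \<Longrightarrow> \<exists>k. (\<lambda>_. 0)(i := k) \<in> H"
      by (metis Suc_leD)
    obtain N where N: "r \<notin> mon_ideal (insert ((\<lambda>_. 0)(n := N)) H)"
      using Inter_add_x_power[OF H(1), of n r] H(3) Suc.prems by auto
    have "\<exists>k. (\<lambda>_. 0)(i := k) \<in> insert ((\<lambda>_. 0)(n := N)) H" if "i < Suc n" for i
      using H(4)[of i] that by (cases "i = n") auto
    then show ?case using H(1,2) N by (intro exI[of _ "insert ((\<lambda>_. 0)(n := N)) H"]) blast
  qed
  then show ?thesis by blast
qed

text \<open>Intersecting with coprime monomials amounts to adjoining their product. Division by the
  power of \<open>x i\<close> leaves \<open>g(i := 0)\<close> unchanged, so multiplying back yields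
  \<open>g\<close> from this generator and multiples of the old generators from the others.\<close>

lemma mon_ideal_insert_coprime:
  assumes "finite G" "i < d"
    and r1: "r \<in> mon_ideal (insert ((\<lambda>_. 0)(i := g i)) G)" and r2: "r \<in> mon_ideal (insert (g(i := 0)) G)"
  shows "r \<in> mon_ideal (insert g G)"
proof -
  let ?e = "(\<lambda>_. 0)(i := g i) :: nat \<Rightarrow> nat" and ?g = "g(i := 0)"
  obtain h u where hu: "h \<in> mon_ideal G" "u \<in> carrier R" "r = h \<oplus> u \<otimes> mon ?e"
    by (rule mon_ideal_insert_decomp[OF r1])
  have hc: "h \<in> carrier R" by (rule mon_ideal_carrier[OF hu(1)])
  have "h \<in> mon_ideal (insert ?g G)" using hu(1) mon_ideal_mono[of G "insert ?g G"] by blast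
  then have "r \<ominus> h \<in> mon_ideal (insert ?g G)" by (rule ideal_minus[OF mon_ideal_ideal r2])
  moreover have "r \<ominus> h = mon ?e \<otimes> u" unfolding hu(3) by (rule add_minus_cancel_comm[OF hc hu(2) mon_closed])
  ultimately have "u \<in> mon_ideal ((\<lambda>g' j. g' j - ?e j) ` insert ?g G)"
    using assms(1) hu(2) by (intro colon_mon[where f = ?e]) (simp_all only: finite_insert)
  then have "mon ?e \<otimes> u \<in> mon_ideal (insert g G)"
  proof (rule mult_Idl_subset[rotated 4])
    fix a assume "a \<in> mon ` (\<lambda>g' j. g' j - ?e j) ` insert ?g G"
    then obtain g' where g': "g' \<in> insert ?g G" "a = mon (\<lambda>j. g' j - ?e j)" by blast
    \<comment> \<open>With truncation this exponent is the pointwise maximum, that is, a least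
      common multiple.\<close>
    have *: "mon ?e \<otimes> a = mon (\<lambda>j. ?e j + (g' j - ?e j))" unfolding g'(2) mon_add ..
    show "mon ?e \<otimes> a \<in> mon_ideal (insert g G)"
    proof (cases "g' = ?g")
      case True
      then show ?thesis unfolding * by (intro mon_in_mon_ideal[of g]) auto
    next
      case False
      then show ?thesis unfolding * using g'(1) by (intro mon_in_mon_ideal[of g']) auto
    qed
  qed (rule mon_image_closed mon_ideal_ideal mon_closed)+
  then have "u \<otimes> mon ?e \<in> mon_ideal (insert g G)" using hu(2) by (simp add: m_comm)
  moreover have "h \<in> mon_ideal (insert g G)" using hu(1) mon_ideal_mono[of G "insert g G"] by blast
  ultimately show ?thesis unfolding hu(3) using ideal_add[OF mon_ideal_ideal] by blast
qed

text \<open>A generator involving two parameters is replaced by its power of one of them or by the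
  complementary factor; by \<open>mon_ideal_insert_coprime\<close> one of these larger ideals still
  omits \<open>r\<close>. The process ends at pure powers. The first conclusion says that no
  generator divides \<open>mon b\<close>; it passes back to \<open>g\<close> because the replacement
  divides \<open>g\<close>.\<close>

lemma irreducible_component_finite:
  assumes "finite G" "r \<in> carrier R" "r \<notin> mon_ideal G" "\<And>i. i < d \<Longrightarrow> \<exists>k. (\<lambda>_. 0)(i := k) \<in> G"
  shows "\<exists>b. (\<forall>g\<in>G. \<exists>i<d. b i < g i) \<and> r \<notin> mon_ideal {(\<lambda>_. 0)(i := Suc (b i)) | i. i < d}"
  using assms(1,3,4)
proof (induction "sum deg G" arbitrary: G rule: less_induct)
  case less
  show ?case
  proof (cases "\<exists>g\<in>G. \<exists>i<d. \<exists>j<d. i \<noteq> j \<and> 0 < g i \<and> 0 < g j")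
    case True
    then obtain g i j where g: "g \<in> G" "i < d" "j < d" "i \<noteq> j" "0 < g i" "0 < g j" by blast
    define G1 where "G1 = G - {g}"
    have G1: "finite G1" "G = insert g G1" "g \<notin> G1" using less.prems(1) g(1) by (auto simp: G1_def)
    have IH: "\<exists>b. (\<forall>g\<in>G. \<exists>i<d. b i < g i) \<and> r \<notin> mon_ideal {(\<lambda>_. 0)(i := Suc (b i)) | i. i < d}"
      if h: "r \<notin> mon_ideal (insert h G1)" "\<And>i. h i \<le> g i" "l < d" "h l < g l" for h l
    proof -
      have "deg h < deg g" unfolding deg_def by (rule sum_strict_mono_ex1) (use h in auto)
      then have "sum deg (insert h G1) < sum deg G"
        unfolding G1(2) using G1 by (simp add: sum.insert_if)
      moreover have "\<exists>k. (\<lambda>_. 0)(i' := k) \<in> insert h G1" if i': "i' < d" for i'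
      proof -
        obtain k where k: "(\<lambda>_. 0)(i' := k) \<in> G" using less.prems(3)[OF i'] by blast
        \<comment> \<open>A pure power cannot be the generator being replaced, since that one
          involves two parameters.\<close>
        moreover have "(\<lambda>_. 0)(i' := k) \<noteq> g" using g(4-6) by (metis fun_upd_apply less_numeral_extra(3))
        ultimately show ?thesis using G1 by auto
      qed
      ultimately obtain b where b: "\<forall>g\<in>insert h G1. \<exists>i<d. b i < g i"
          "r \<notin> mon_ideal {(\<lambda>_. 0)(i := Suc (b i)) | i. i < d}"
        using less.hyps[of "insert h G1"] h(1) G1(1) by blast
      moreover have "\<exists>i<d. b i < g i" using b(1) h(2) by (meson insertI1 less_le_trans)
      ultimately show ?thesis unfolding G1(2) by blast
    qed
    consider "r \<notin> mon_ideal (insert ((\<lambda>_. 0)(i := g i)) G1)" | "r \<notin> mon_ideal (insert (g(i := 0)) G1)"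
      using mon_ideal_insert_coprime[OF G1(1) g(2)] less.prems(2) unfolding G1(2) by blast
    then show ?thesis
    proof cases
      case 1 then show ?thesis using IH[of "(\<lambda>_. 0)(i := g i)" j] g by simp
    next
      case 2 then show ?thesis using IH[of "g(i := 0)" i] g by simp
    qed
  next
    case False
    have single: "g j = 0" if "g \<in> G" "i < d" "j < d" "i \<noteq> j" "0 < g i" for g i j
    proof (rule ccontr)
      assume "g j \<noteq> 0"
      then have "\<exists>g\<in>G. \<exists>i<d. \<exists>j<d. i \<noteq> j \<and> 0 < g i \<and> 0 < g j"
        using that by (intro bexI[of _ g] exI[of _ i] exI[of _ j] conjI) auto
      with False show False by (rule notE)
    qed
    have nz: "\<exists>i<d. 0 < g i" if "g \<in> G" for g
      using mon_ideal_one[OF that _ assms(2)] less.prems(2) by (meson gr0I)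
    \<comment> \<open>\<open>K i k\<close> says that the \<open>k\<close>-th power of
      \<open>x i\<close> is a generator, up to coordinates that \<open>mon\<close> does not see. The
      least such \<open>k\<close> will be \<open>Suc (b i)\<close>.\<close>
    define K where "K i k \<longleftrightarrow> 0 < k \<and> (\<exists>g\<in>G. \<forall>j<d. g j = (if j = i then k else 0))" for i k
    have K1: "K i (g i)" if "g \<in> G" "i < d" "0 < g i" for g i
      unfolding K_def using that single[OF that(1,2)] by (intro conjI bexI[of _ g]) auto
    have K2: "\<exists>k. K i k" if i: "i < d" for i
    proof -
      obtain k where k: "(\<lambda>_. 0)(i := k) \<in> G" using less.prems(3)[OF i] by blast
      have "0 < k" using nz[OF k] by (metis fun_upd_apply less_numeral_extra(3))
      then show ?thesis using K1[OF k i] by auto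
    qed
    define b where "b i = (LEAST k. K i k) - 1" for i
    have b1: "K i (Suc (b i))" if "i < d" for i
    proof -
      have "K i (LEAST k. K i k)" using LeastI_ex[OF K2[OF that]] .
      moreover from this have "0 < (LEAST k. K i k)" unfolding K_def by blast
      ultimately show ?thesis by (simp add: b_def)
    qed
    have b2: "b i < g i" if "g \<in> G" "i < d" "0 < g i" for g i
      using Least_le[of "K i", OF K1[OF that]] that by (simp add: b_def)
    have "mon_ideal {(\<lambda>_. 0)(i := Suc (b i)) | i. i < d} \<subseteq> mon_ideal G"
    proof (rule mon_ideal_subset)
      fix g assume "g \<in> {(\<lambda>_. 0)(i := Suc (b i)) | i. i < d}"
      then obtain i where i: "i < d" "g = (\<lambda>_. 0)(i := Suc (b i))" by blast
      then obtain h where "h \<in> G" "\<forall>j<d. h j = (if j = i then Suc (b i) else 0)"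
        using b1[OF i(1)] unfolding K_def by blast
      then show "\<exists>h\<in>G. \<forall>j<d. h j \<le> g j" unfolding i(2) by (intro bexI[of _ h]) simp_all
    qed
    then have "r \<notin> mon_ideal {(\<lambda>_. 0)(i := Suc (b i)) | i. i < d}" using less.prems(2) by blast
    moreover have "\<forall>g\<in>G. \<exists>i<d. b i < g i" using b2 nz by blast
    ultimately show ?thesis by blast
  qed
qed

text \<open>Noetherianity yields finitely many generators in \<open>R\<close>, which need not be
  monomials; each of them uses only finitely many of the given monomials.\<close>

lemma mon_ideal_finitely_generated:
  obtains G where "finite G" "G \<subseteq> K" "mon_ideal G = mon_ideal K"
proof -
  obtain A where A: "A \<subseteq> carrier R" "finite A" "mon_ideal K = Idl A"
    using finetely_gen[OF mon_ideal_ideal] by metis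
  have "\<exists>H. finite H \<and> H \<subseteq> K \<and> a \<in> mon_ideal H" if "a \<in> A" for a
  proof -
    have "a \<in> mon_ideal K" using genideal_self[OF A(1)] that A(3) by blast
    then show ?thesis using mon_ideal_finite_subset by metis
  qed
  then obtain H where H: "\<And>a. a \<in> A \<Longrightarrow> finite (H a) \<and> H a \<subseteq> K \<and> a \<in> mon_ideal (H a)" by metis
  define G where "G = \<Union> (H ` A)"
  have "A \<subseteq> mon_ideal G"
  proof
    fix a assume a: "a \<in> A"
    then have "mon_ideal (H a) \<subseteq> mon_ideal G" unfolding G_def by (intro mon_ideal_mono) blast
    then show "a \<in> mon_ideal G" using H[OF a] by blast
  qed
  then have "mon_ideal K \<subseteq> mon_ideal G" unfolding A(3) by (rule Idl_subsetI[OF mon_ideal_ideal])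
  moreover have "G \<subseteq> K" unfolding G_def using H by blast
  ultimately have "mon_ideal G = mon_ideal K" using mon_ideal_mono[of G K] by blast
  moreover have "finite G" unfolding G_def using A(2) H by blast
  ultimately show thesis using that \<open>G \<subseteq> K\<close> by blast
qed

lemma irreducible_component:
  assumes r: "r \<in> carrier R" "r \<notin> mon_ideal K"
  obtains b where "\<And>g. g \<in> K \<Longrightarrow> \<exists>i<d. b i < g i"
    "r \<notin> mon_ideal {(\<lambda>_. 0)(i := Suc (b i)) | i. i < d}"
proof -
  obtain G where G: "finite G" "G \<subseteq> K" "mon_ideal G = mon_ideal K"
    by (rule mon_ideal_finitely_generated)
  obtain H where H: "finite H" "G \<subseteq> H" "r \<notin> mon_ideal H" "\<And>i. i < d \<Longrightarrow> \<exists>k. (\<lambda>_. 0)(i := k) \<in> H"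
    using add_x_powers[OF G(1), of r] r(2) G(3) by metis
  obtain b where b: "\<forall>g\<in>H. \<exists>i<d. b i < g i" "r \<notin> mon_ideal {(\<lambda>_. 0)(i := Suc (b i)) | i. i < d}"
    using irreducible_component_finite[OF H(1) r(1) H(3,4)] by blast
  \<comment> \<open>Non-divisibility is known on the finite set \<open>H\<close> only; passing
    through membership of \<open>mon b\<close> extends it to all of \<open>K\<close>.\<close>
  have "mon b \<notin> mon_ideal G" using b(1) H(2) by (intro mon_notin_mon_ideal) blast
  then have "mon b \<notin> mon_ideal K" using G(3) by simp
  then have "\<exists>i<d. b i < g i" if "g \<in> K" for g
    using mon_in_mon_ideal[OF that, of b] by (meson not_le)
  then show thesis using that b(2) by blast
qed

end

section \<open>The determinant trick\<close>

text \<open>The elements of \<open>lower_terms R J y n\<close> are the sums of \<open>c\<^sub>i y\<^bsup>n-i\<^esup>\<close> with \<open>c\<^sub>i \<in> J\<^sup>i\<close> and \<open>1 \<le> i \<le> n\<close>.\<close>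

primrec lower_terms :: "('a, 'b) ring_scheme \<Rightarrow> 'a set \<Rightarrow> 'a \<Rightarrow> nat \<Rightarrow> 'a set" where
  "lower_terms R J y 0 = {\<zero>\<^bsub>R\<^esub>}"
| "lower_terms R J y (Suc n) = {y \<otimes>\<^bsub>R\<^esub> w \<oplus>\<^bsub>R\<^esub> c | w c. w \<in> lower_terms R J y n \<and> c \<in> ideal_pow R J (Suc n)}"

text \<open>Zero lying in this set for some \<open>n \<ge> 1\<close> is integrality of
  \<open>y\<close> over \<open>J\<close>. Sets of values allow equations to be multiplied and
  subtracted without polynomials.\<close>

definition monic_terms :: "('a, 'b) ring_scheme \<Rightarrow> 'a set \<Rightarrow> 'a \<Rightarrow> nat \<Rightarrow> 'a set" where
  "monic_terms R J y n = {y [^]\<^bsub>R\<^esub> n \<oplus>\<^bsub>R\<^esub> w | w. w \<in> lower_terms R J y n}"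

context cring
begin

lemma ideal_pow_ideal: "ideal I R \<Longrightarrow> ideal (ideal_pow R I n) R"
  by (induction n) (simp_all add: oneideal ideal_prod_is_ideal)

lemma ideal_pow_carrier: "ideal I R \<Longrightarrow> a \<in> ideal_pow R I n \<Longrightarrow> a \<in> carrier R"
  by (rule ideal.Icarr[OF ideal_pow_ideal])

lemma ideal_pow_mult:
  assumes I: "ideal I R" and a: "a \<in> ideal_pow R I m" and b: "b \<in> ideal_pow R I n"
  shows "a \<otimes> b \<in> ideal_pow R I (m + n)"
  using a
proof (induction m arbitrary: a)
  case 0
  then show ?case using ideal.I_l_closed[OF ideal_pow_ideal[OF I] b] by simp
next
  case (Suc m)
  have bc: "b \<in> carrier R" by (rule ideal_pow_carrier[OF I b])
  from Suc.prems have "a \<in> I \<cdot> ideal_pow R I m" by simp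
  then have "a \<in> carrier R \<and> a \<otimes> b \<in> I \<cdot> ideal_pow R I (m + n)"
  proof (induction rule: ideal_prod.induct)
    case (prod i j)
    have ij: "i \<in> carrier R" "j \<in> carrier R"
      using ideal.Icarr[OF I prod(1)] ideal_pow_carrier[OF I prod(2)] by auto
    then show ?case using ideal_prod.prod[OF prod(1) Suc.IH[OF prod(2)], of R] bc by (simp add: m_assoc)
  next
    case (sum s1 s2)
    then show ?case using bc ideal_prod.sum by (auto simp: l_distr)
  qed
  then show ?case by simp
qed

lemma ideal_pow_1I:
  assumes "ideal I R" "a \<in> I" shows "a \<in> ideal_pow R I 1"
proof -
  have "a \<otimes> \<one> \<in> I \<cdot> carrier R" by (rule ideal_prod.prod[OF assms(2) one_closed])
  then show ?thesis using ideal.Icarr[OF assms] by simp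
qed

section \<open>Graded arithmetic of integral equations\<close>

context
  fixes J y
  assumes J: "ideal J R" and y: "y \<in> carrier R"
begin

abbreviation "L \<equiv> lower_terms R J y"
abbreviation "M \<equiv> monic_terms R J y"

lemma lower_SucI: "w \<in> L n \<Longrightarrow> c \<in> ideal_pow R J (Suc n) \<Longrightarrow> y \<otimes> w \<oplus> c \<in> L (Suc n)"
  by auto

lemma lower_SucE:
  assumes "v \<in> L (Suc n)" obtains w c where "w \<in> L n" "c \<in> ideal_pow R J (Suc n)" "v = y \<otimes> w \<oplus> c"
  using assms by auto

declare lower_terms.simps(2) [simp del]

lemma lower_ideal: "ideal (L n) R"
proof (induction n)
  case 0 then show ?case by (simp add: zeroideal)
next
  case (Suc n)
  note P = ideal_pow_ideal[OF J, of "Suc n"]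
  show ?case
  proof (rule ideal_of_closedI)
    show "L (Suc n) \<subseteq> carrier R"
    proof
      fix v assume "v \<in> L (Suc n)"
      then obtain w c where "w \<in> L n" "c \<in> ideal_pow R J (Suc n)" "v = y \<otimes> w \<oplus> c" by (rule lower_SucE)
      then show "v \<in> carrier R" using ideal.Icarr[OF Suc] ideal.Icarr[OF P] y by simp
    qed
    show "\<zero> \<in> L (Suc n)" using lower_SucI[OF ideal_zero[OF Suc] ideal_zero[OF P]] y by simp
  next
    fix a b assume "a \<in> L (Suc n)" "b \<in> L (Suc n)"
    obtain w c where a: "w \<in> L n" "c \<in> ideal_pow R J (Suc n)" "a = y \<otimes> w \<oplus> c"
      by (rule lower_SucE[OF \<open>a \<in> L (Suc n)\<close>])
    obtain w' c' where b: "w' \<in> L n" "c' \<in> ideal_pow R J (Suc n)" "b = y \<otimes> w' \<oplus> c'"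
      by (rule lower_SucE[OF \<open>b \<in> L (Suc n)\<close>])
    have cc: "w \<in> carrier R" "w' \<in> carrier R" "c \<in> carrier R" "c' \<in> carrier R"
      using ideal.Icarr[OF Suc a(1)] ideal.Icarr[OF Suc b(1)] ideal.Icarr[OF P a(2)] ideal.Icarr[OF P b(2)] by auto
    have "a \<oplus> b = y \<otimes> (w \<oplus> w') \<oplus> (c \<oplus> c')" unfolding a(3) b(3) using cc y by algebra
    then show "a \<oplus> b \<in> L (Suc n)" using lower_SucI[OF ideal_add[OF Suc a(1) b(1)] ideal_add[OF P a(2) b(2)]] by simp
  next
    fix e a assume e: "e \<in> carrier R" and "a \<in> L (Suc n)"
    obtain w c where a: "w \<in> L n" "c \<in> ideal_pow R J (Suc n)" "a = y \<otimes> w \<oplus> c"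
      by (rule lower_SucE[OF \<open>a \<in> L (Suc n)\<close>])
    have cc: "w \<in> carrier R" "c \<in> carrier R"
      using ideal.Icarr[OF Suc a(1)] ideal.Icarr[OF P a(2)] by auto
    have "e \<otimes> a = y \<otimes> (e \<otimes> w) \<oplus> e \<otimes> c" unfolding a(3) using cc y e by algebra
    then show "e \<otimes> a \<in> L (Suc n)"
      using lower_SucI[OF ideal.I_l_closed[OF Suc a(1) e] ideal.I_l_closed[OF P a(2) e]] by simp
  qed
qed

lemma lower_carrier: "w \<in> L n \<Longrightarrow> w \<in> carrier R"
  by (rule ideal.Icarr[OF lower_ideal])

lemma lower_mult_y: "w \<in> L n \<Longrightarrow> y \<otimes> w \<in> L (Suc n)"
  using lower_SucI[OF _ ideal_zero[OF ideal_pow_ideal[OF J, of "Suc n"]]] lower_carrier y by fastforce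

lemma lower_of_ideal_pow: "c \<in> ideal_pow R J (Suc n) \<Longrightarrow> c \<in> L (Suc n)"
  using lower_SucI[OF ideal_zero[OF lower_ideal[of n]], of c] ideal_pow_carrier[OF J, of c "Suc n"] y by simp

text \<open>Give \<open>y\<close> and \<open>J\<close> degree one. Then \<open>L n\<close> holds the
  values of forms of degree \<open>n\<close> without the pure power of \<open>y\<close>, and
  \<open>M n\<close> those with leading coefficient one. The product rules here and below are
  additivity of degrees.\<close>

lemma ideal_pow_mult_lower:
  assumes a: "a \<in> ideal_pow R J m" shows "w \<in> L n \<Longrightarrow> a \<otimes> w \<in> L (m + n)"
proof (induction n arbitrary: w)
  case 0
  then show ?case using ideal_pow_carrier[OF J a] ideal_zero[OF lower_ideal[of m]] by simp
next
  case (Suc n)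
  obtain v c where v: "v \<in> L n" "c \<in> ideal_pow R J (Suc n)" "w = y \<otimes> v \<oplus> c"
    by (rule lower_SucE[OF Suc.prems])
  have cc: "v \<in> carrier R" "c \<in> carrier R" "a \<in> carrier R"
    using lower_carrier[OF v(1)] ideal_pow_carrier[OF J v(2)] ideal_pow_carrier[OF J a] by auto
  have "a \<otimes> w = y \<otimes> (a \<otimes> v) \<oplus> a \<otimes> c" unfolding v(3) using cc y by algebra
  then show ?case using lower_SucI[OF Suc.IH[OF v(1)], of "a \<otimes> c"] ideal_pow_mult[OF J a v(2)] by simp
qed

lemma lower_mult_lower: "v \<in> L m \<Longrightarrow> w \<in> L n \<Longrightarrow> v \<otimes> w \<in> L (m + n)"
proof (induction m arbitrary: v)
  case 0
  then show ?case using lower_carrier[of w n] ideal_zero[OF lower_ideal[of n]] by simp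
next
  case (Suc m)
  obtain u c where v: "u \<in> L m" "c \<in> ideal_pow R J (Suc m)" "v = y \<otimes> u \<oplus> c"
    by (rule lower_SucE[OF Suc.prems(1)])
  have cc: "u \<in> carrier R" "c \<in> carrier R" "w \<in> carrier R"
    using lower_carrier[OF v(1)] ideal_pow_carrier[OF J v(2)] lower_carrier[OF Suc.prems(2)] by auto
  have "v \<otimes> w = y \<otimes> (u \<otimes> w) \<oplus> c \<otimes> w" unfolding v(3) using cc y by algebra
  moreover have "y \<otimes> (u \<otimes> w) \<in> L (Suc m + n)" using lower_mult_y[OF Suc.IH[OF v(1) Suc.prems(2)]] by simp
  ultimately show ?case using ideal_add[OF lower_ideal] ideal_pow_mult_lower[OF v(2) Suc.prems(2)] by simp
qed

lemma y_pow_mult_lower: "w \<in> L n \<Longrightarrow> y [^] k \<otimes> w \<in> L (k + n)"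
proof (induction k)
  case 0 then show ?case using lower_carrier[of w n] by simp
next
  case (Suc k)
  have "y [^] Suc k \<otimes> w = y \<otimes> (y [^] k \<otimes> w)"
    using y lower_carrier[OF Suc.prems] by (simp add: m_assoc m_lcomm)
  then show ?case using lower_mult_y[OF Suc.IH[OF Suc.prems]] by simp
qed

lemma monicE:
  assumes "v \<in> M n" obtains w where "w \<in> L n" "w \<in> carrier R" "v = y [^] n \<oplus> w"
  using assms lower_carrier by (auto simp: monic_terms_def)

lemma monicI: "w \<in> L n \<Longrightarrow> y [^] n \<oplus> w \<in> M n"
  by (auto simp: monic_terms_def)

lemma monic_carrier: "v \<in> M n \<Longrightarrow> v \<in> carrier R"
  using y by (auto elim!: monicE)

lemma monic_mult_lower:
  assumes "v \<in> M m" "w \<in> L n" shows "v \<otimes> w \<in> L (m + n)"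
proof -
  obtain u where u: "u \<in> L m" "u \<in> carrier R" "v = y [^] m \<oplus> u" by (rule monicE[OF assms(1)])
  have "v \<otimes> w = y [^] m \<otimes> w \<oplus> u \<otimes> w" unfolding u(3) using y u(2) lower_carrier[OF assms(2)] by (simp add: l_distr)
  then show ?thesis
    using ideal_add[OF lower_ideal y_pow_mult_lower[OF assms(2)] lower_mult_lower[OF u(1) assms(2)]] by simp
qed

lemma monic_mult_monic:
  assumes "v \<in> M m" "w \<in> M n" shows "v \<otimes> w \<in> M (m + n)"
proof -
  obtain u where u: "u \<in> L m" "u \<in> carrier R" "v = y [^] m \<oplus> u" by (rule monicE[OF assms(1)])
  obtain t where t: "t \<in> L n" "t \<in> carrier R" "w = y [^] n \<oplus> t" by (rule monicE[OF assms(2)])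
  define a where "a = y [^] m"
  define b where "b = y [^] n"
  have ab: "a \<in> carrier R" "b \<in> carrier R" "y [^] (m + n) = a \<otimes> b"
    using y by (auto simp: a_def b_def nat_pow_mult)
  have "v \<otimes> w = y [^] (m + n) \<oplus> (v \<otimes> t \<oplus> b \<otimes> u)"
    unfolding u(3) t(3) ab(3) a_def[symmetric] b_def[symmetric] using u(2) t(2) ab(1,2) by algebra
  moreover have "b \<otimes> u \<in> L (m + n)" using y_pow_mult_lower[OF u(1), of n] by (simp add: b_def add.commute)
  ultimately show ?thesis
    using monicI[OF ideal_add[OF lower_ideal monic_mult_lower[OF assms(1) t(1)]]] by simp
qed

lemma monic_minus_lower:
  assumes "v \<in> M n" "w \<in> L n" shows "v \<ominus> w \<in> M n"
proof -
  obtain u where u: "u \<in> L n" "u \<in> carrier R" "v = y [^] n \<oplus> u" by (rule monicE[OF assms(1)])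
  have "v \<ominus> w = y [^] n \<oplus> (u \<ominus> w)"
    unfolding u(3) minus_eq using u(2) y lower_carrier[OF assms(2)] by (simp add: a_assoc)
  then show ?thesis using monicI[OF ideal_minus[OF lower_ideal u(1) assms(2)]] by simp
qed

text \<open>Unrolls the Horner form of \<open>lower_terms\<close> into the sum that
  \<open>int_closure\<close> asks for. The newest coefficient gets index \<open>Suc n\<close>, where
  the power of \<open>y\<close> has exponent zero.\<close>

lemma lower_eq_finsum:
  "w \<in> L n \<Longrightarrow> \<exists>c. (\<forall>i\<in>{1..n}. c i \<in> ideal_pow R J i) \<and> w = finsum R (\<lambda>i. c i \<otimes> y [^] (n - i)) {1..n}"
proof (induction n arbitrary: w)
  case 0 then show ?case by simp
next
  case (Suc n)
  obtain v e where v: "v \<in> L n" "e \<in> ideal_pow R J (Suc n)" "w = y \<otimes> v \<oplus> e"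
    by (rule lower_SucE[OF Suc.prems])
  obtain c where c: "\<forall>i\<in>{1..n}. c i \<in> ideal_pow R J i" "v = finsum R (\<lambda>i. c i \<otimes> y [^] (n - i)) {1..n}"
    using Suc.IH[OF v(1)] by blast
  have cc: "c i \<in> carrier R" if "i \<in> {1..n}" for i using c(1) that ideal_pow_carrier[OF J] by blast
  have ec: "e \<in> carrier R" by (rule ideal_pow_carrier[OF J v(2)])
  define c' where "c' = c(Suc n := e)"
  have "y \<otimes> v = finsum R (\<lambda>i. y \<otimes> (c i \<otimes> y [^] (n - i))) {1..n}"
    unfolding c(2) by (rule finsum_rdistr) (use cc y in auto)
  also have "\<dots> = finsum R (\<lambda>i. c' i \<otimes> y [^] (Suc n - i)) {1..n}"
  proof (rule finsum_cong')
    fix i assume i: "i \<in> {1..n}"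
    then have "Suc n - i = Suc (n - i)" by auto
    then show "y \<otimes> (c i \<otimes> y [^] (n - i)) = c' i \<otimes> y [^] (Suc n - i)"
      using i cc[OF i] y by (simp add: c'_def m_lcomm m_comm)
  qed (use cc y in \<open>auto simp: c'_def\<close>)
  finally have yv: "y \<otimes> v = finsum R (\<lambda>i. c' i \<otimes> y [^] (Suc n - i)) {1..n}" .
  have "finsum R (\<lambda>i. c' i \<otimes> y [^] (Suc n - i)) {1..Suc n}
      = finsum R (\<lambda>i. c' i \<otimes> y [^] (Suc n - i)) (insert (Suc n) {1..n})"
    by (simp add: atLeastAtMostSuc_conv)
  also have "\<dots> = c' (Suc n) \<otimes> y [^] (Suc n - Suc n) \<oplus> finsum R (\<lambda>i. c' i \<otimes> y [^] (Suc n - i)) {1..n}"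
    by (rule finsum_insert) (use cc y ec in \<open>auto simp: c'_def\<close>)
  also have "\<dots> = w"
    unfolding yv[symmetric] v(3) using ec y lower_carrier[OF v(1)] by (simp add: c'_def a_comm)
  finally have "w = finsum R (\<lambda>i. c' i \<otimes> y [^] (Suc n - i)) {1..Suc n}" ..
  moreover have "\<forall>i\<in>{1..Suc n}. c' i \<in> ideal_pow R J i"
    using c(1) v(2) unfolding c'_def by (auto simp: atLeastAtMostSuc_conv)
  ultimately show ?case by blast
qed

lemma int_closure_of_monic_zero:
  assumes "\<zero> \<in> M n" "1 \<le> n" shows "y \<in> int_closure R J"
proof -
  obtain w where w: "w \<in> L n" "\<zero> = y [^] n \<oplus> w" using assms(1) by (auto elim: monicE)
  then show ?thesis using lower_eq_finsum[OF w(1)] assms(2) y unfolding int_closure_def by fastforce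
qed

text \<open>The determinant trick by Gaussian elimination: cross-multiplying rows keeps the diagonal monic
  and the off-diagonal entries of lower order.\<close>

lemma eliminate_monic_system:
  assumes "finite T" "t \<notin> T" "1 \<le> n"
    and "\<And>i. i \<in> insert t T \<Longrightarrow> m i \<in> carrier R"
    and "\<And>i. i \<in> insert t T \<Longrightarrow> B i i \<in> M n"
    and "\<And>i j. i \<in> insert t T \<Longrightarrow> j \<in> insert t T \<Longrightarrow> i \<noteq> j \<Longrightarrow> B i j \<in> L n"
    and "\<And>i. i \<in> insert t T \<Longrightarrow> finsum R (\<lambda>j. B i j \<otimes> m j) (insert t T) = \<zero>"
  shows "\<exists>N\<ge>1. \<exists>\<theta>\<in>M N. \<theta> \<otimes> m t = \<zero>"
  using assms
proof (induction T arbitrary: B n rule: finite_induct)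
  case empty
  have "B t t \<otimes> m t = \<zero>"
    using empty.prems(6)[of t] monic_carrier[OF empty.prems(4)[of t]] empty.prems(3)[of t] by simp
  then show ?case using empty.prems(2) empty.prems(4)[of t] by blast
next
  case (insert k T)
  let ?U = "insert t T"
  have kU: "k \<notin> ?U" "finite ?U" and sub: "?U \<subseteq> insert t (insert k T)" and ins: "insert t (insert k T) = insert k ?U"
    using insert.hyps insert.prems(1) by auto
  have Bc: "B i j \<in> carrier R" if "i \<in> insert k ?U" "j \<in> insert k ?U" for i j
    using insert.prems(4)[of i] insert.prems(5)[of i j] that monic_carrier lower_carrier
    by (cases "i = j") (auto simp: ins)
  have mc: "m j \<in> carrier R" if "j \<in> insert k ?U" for j using insert.prems(3)[of j] that by (auto simp: ins)
  have kk: "k \<in> insert k ?U" by simp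
  define S where "S i = finsum R (\<lambda>j. B i j \<otimes> m j) ?U" for i
  have Sc: "S i \<in> carrier R" if "i \<in> insert k ?U" for i
    unfolding S_def using Bc[OF that] mc by (intro finsum_closed) auto
  have row: "B i k \<otimes> m k \<oplus> S i = \<zero>" if i: "i \<in> insert k ?U" for i
  proof -
    have "finsum R (\<lambda>j. B i j \<otimes> m j) (insert k ?U) = B i k \<otimes> m k \<oplus> S i"
      unfolding S_def by (rule finsum_insert) (use kU Bc[OF i] mc in auto)
    then show ?thesis using insert.prems(6)[of i] i by (simp add: ins)
  qed
  define B' where "B' i j = B k k \<otimes> B i j \<ominus> B i k \<otimes> B k j" for i j
  have "\<exists>N\<ge>1. \<exists>\<theta>\<in>M N. \<theta> \<otimes> m t = \<zero>"
  proof (rule insert.IH[of "n + n" B'])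
    show "t \<notin> T" using insert.prems(1) by auto
    show "1 \<le> n + n" using insert.prems(2) by simp
    show "m i \<in> carrier R" if "i \<in> ?U" for i using mc that by auto
    have Mk: "B k k \<in> M n" using insert.prems(4)[of k] by auto
    have Lk: "B i k \<in> L n" "B k i \<in> L n" if "i \<in> ?U" for i
      using insert.prems(5)[of i k] insert.prems(5)[of k i] that kU by auto
    show "B' i i \<in> M (n + n)" if i: "i \<in> ?U" for i
      unfolding B'_def using insert.prems(4)[of i] i
      by (intro monic_minus_lower monic_mult_monic lower_mult_lower Mk Lk) auto
    show "B' i j \<in> L (n + n)" if ij: "i \<in> ?U" "j \<in> ?U" "i \<noteq> j" for i j
      unfolding B'_def using insert.prems(5)[of i j] ij
      by (intro ideal_minus[OF lower_ideal] monic_mult_lower lower_mult_lower Mk Lk) auto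
    show "finsum R (\<lambda>j. B' i j \<otimes> m j) ?U = \<zero>" if i: "i \<in> ?U" for i
    proof -
      have iU: "i \<in> insert k ?U" using i by simp
      have "finsum R (\<lambda>j. B' i j \<otimes> m j) ?U
          = finsum R (\<lambda>j. B k k \<otimes> (B i j \<otimes> m j) \<oplus> (\<ominus> B i k) \<otimes> (B k j \<otimes> m j)) ?U"
      proof (rule finsum_cong')
        fix j assume j: "j \<in> ?U"
        have c: "B k k \<in> carrier R" "B i j \<in> carrier R" "B i k \<in> carrier R" "B k j \<in> carrier R" "m j \<in> carrier R"
          using Bc[of k k] Bc[of i j] Bc[of i k] Bc[of k j] mc[of j] iU j by auto
        show "B' i j \<otimes> m j = B k k \<otimes> (B i j \<otimes> m j) \<oplus> (\<ominus> B i k) \<otimes> (B k j \<otimes> m j)"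
          unfolding B'_def using c by algebra
      qed (use Bc iU mc in auto)
      also have "\<dots> = finsum R (\<lambda>j. B k k \<otimes> (B i j \<otimes> m j)) ?U \<oplus> finsum R (\<lambda>j. (\<ominus> B i k) \<otimes> (B k j \<otimes> m j)) ?U"
        by (rule finsum_addf) (use Bc iU mc in auto)
      also have "finsum R (\<lambda>j. B k k \<otimes> (B i j \<otimes> m j)) ?U = B k k \<otimes> S i"
        unfolding S_def by (rule finsum_rdistr[symmetric]) (use Bc iU mc kU in auto)
      also have "finsum R (\<lambda>j. (\<ominus> B i k) \<otimes> (B k j \<otimes> m j)) ?U = (\<ominus> B i k) \<otimes> S k"
        unfolding S_def by (rule finsum_rdistr[symmetric]) (use Bc iU mc kU in auto)
      \<comment> \<open>The terms in \<open>m k\<close> cancel, so they may be inserted to complete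
        both row sums.\<close>
      also have "B k k \<otimes> S i \<oplus> (\<ominus> B i k) \<otimes> S k
          = B k k \<otimes> (B i k \<otimes> m k \<oplus> S i) \<oplus> (\<ominus> B i k) \<otimes> (B k k \<otimes> m k \<oplus> S k)"
        using Bc[OF kk kk] Bc[OF iU kk] mc[OF kk] Sc[OF iU] Sc[OF kk] by algebra
      also have "\<dots> = \<zero>" unfolding row[OF iU] row[OF kk] using Bc[OF kk kk] Bc[OF iU kk] by simp
      finally show ?thesis .
    qed
  qed
  then show ?case .
qed

end

text \<open>For finite \<open>B\<close> this is the product of \<open>J\<close> with the ideal
  generated by \<open>B\<close>, written with one coefficient from \<open>J\<close> per generator so
  that a matrix over \<open>J\<close> can be read off.\<close>

definition ideal_combinations :: "'a set \<Rightarrow> 'a set \<Rightarrow> 'a set" where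
  "ideal_combinations J B = {finsum R (\<lambda>b. \<mu> b \<otimes> b) B | \<mu>. \<forall>b\<in>B. \<mu> b \<in> J}"

lemma ideal_combinations_ideal:
  assumes J: "ideal J R" and B: "B \<subseteq> carrier R" "finite B"
  shows "ideal (ideal_combinations J B) R"
proof (rule ideal_of_closedI)
  have Jc: "a \<in> carrier R" if "a \<in> J" for a using ideal.Icarr[OF J that] .
  show "ideal_combinations J B \<subseteq> carrier R"
  proof
    fix v assume "v \<in> ideal_combinations J B"
    then obtain \<mu> where \<mu>: "\<forall>b\<in>B. \<mu> b \<in> J" "v = finsum R (\<lambda>b. \<mu> b \<otimes> b) B" unfolding ideal_combinations_def by blast
    show "v \<in> carrier R" unfolding \<mu>(2) by (rule finsum_closed) (use \<mu>(1) Jc B in auto)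
  qed
  have "finsum R (\<lambda>b. \<zero> \<otimes> b) B = finsum R (\<lambda>b. \<zero>) B" by (rule finsum_cong') (use B in auto)
  then have "finsum R (\<lambda>b. \<zero> \<otimes> b) B = \<zero>" by simp
  then show "\<zero> \<in> ideal_combinations J B"
    unfolding ideal_combinations_def using ideal_zero[OF J] by (intro CollectI exI[of _ "\<lambda>_. \<zero>"]) auto
  show "v \<oplus> w \<in> ideal_combinations J B" if vw: "v \<in> ideal_combinations J B" "w \<in> ideal_combinations J B" for v w
  proof -
    obtain \<mu> where \<mu>: "\<forall>b\<in>B. \<mu> b \<in> J" "v = finsum R (\<lambda>b. \<mu> b \<otimes> b) B" using vw(1) unfolding ideal_combinations_def by blast
    obtain \<nu> where \<nu>: "\<forall>b\<in>B. \<nu> b \<in> J" "w = finsum R (\<lambda>b. \<nu> b \<otimes> b) B" using vw(2) unfolding ideal_combinations_def by blast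
    have "v \<oplus> w = finsum R (\<lambda>b. \<mu> b \<otimes> b \<oplus> \<nu> b \<otimes> b) B"
      unfolding \<mu>(2) \<nu>(2) by (rule finsum_addf[symmetric]) (use \<mu>(1) \<nu>(1) Jc B in auto)
    also have "\<dots> = finsum R (\<lambda>b. (\<mu> b \<oplus> \<nu> b) \<otimes> b) B"
      by (rule finsum_cong') (use \<mu>(1) \<nu>(1) Jc B in \<open>auto simp: l_distr subset_iff\<close>)
    finally show ?thesis
      unfolding ideal_combinations_def using \<mu>(1) \<nu>(1) ideal_add[OF J] by (intro CollectI exI[of _ "\<lambda>b. \<mu> b \<oplus> \<nu> b"]) auto
  qed
  show "c \<otimes> v \<in> ideal_combinations J B" if cv: "c \<in> carrier R" "v \<in> ideal_combinations J B" for c v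
  proof -
    obtain \<mu> where \<mu>: "\<forall>b\<in>B. \<mu> b \<in> J" "v = finsum R (\<lambda>b. \<mu> b \<otimes> b) B" using cv(2) unfolding ideal_combinations_def by blast
    have "c \<otimes> v = finsum R (\<lambda>b. c \<otimes> (\<mu> b \<otimes> b)) B"
      unfolding \<mu>(2) by (rule finsum_rdistr) (use \<mu>(1) Jc B cv(1) in auto)
    also have "\<dots> = finsum R (\<lambda>b. (c \<otimes> \<mu> b) \<otimes> b) B"
      by (rule finsum_cong') (use \<mu>(1) Jc B cv(1) in \<open>auto simp: m_assoc subset_iff\<close>)
    finally show ?thesis
      unfolding ideal_combinations_def using \<mu>(1) ideal.I_l_closed[OF J _ cv(1)] by (intro CollectI exI[of _ "\<lambda>b. c \<otimes> \<mu> b"]) auto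
  qed
qed

lemma mult_Idl_in_ideal_combinations:
  assumes J: "ideal J R" and B: "B \<subseteq> carrier R" "finite B" and a: "a \<in> J" and h: "h \<in> Idl B"
  shows "a \<otimes> h \<in> ideal_combinations J B"
proof (rule mult_Idl_subset[OF B(1) ideal_combinations_ideal[OF J B] _ _ h])
  show ac: "a \<in> carrier R" by (rule ideal.Icarr[OF J a])
  fix b assume b: "b \<in> B"
  have "finsum R (\<lambda>c. (if b = c then a else \<zero>) \<otimes> c) B = finsum R (\<lambda>c. if b = c then a \<otimes> c else \<zero>) B"
    by (rule finsum_cong') (use B ac in auto)
  also have "\<dots> = a \<otimes> b" using b B ac by (intro finsum_singleton) auto
  finally have "a \<otimes> b = finsum R (\<lambda>c. (if b = c then a else \<zero>) \<otimes> c) B" ..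
  then show "a \<otimes> b \<in> ideal_combinations J B"
    unfolding ideal_combinations_def using a ideal_zero[OF J]
    by (intro CollectI exI[of _ "\<lambda>c. if b = c then a else \<zero>"]) auto
qed

end

text \<open>Elimination reduces the system with matrix \<open>y\<close> times the identity minus
  \<open>\<mu>\<close> to one equation \<open>\<theta> \<otimes> t = \<zero>\<close> with
  \<open>\<theta>\<close> monic in \<open>y\<close>. In a domain one nonzero generator
  \<open>t\<close> then gives \<open>\<theta> = \<zero>\<close>.\<close>

lemma (in domain) determinant_trick:
  assumes J: "ideal J R" and y: "y \<in> carrier R" and B: "B \<subseteq> carrier R" "finite B"
    and t: "t \<in> B" "t \<noteq> \<zero>" and comb: "\<And>b. b \<in> B \<Longrightarrow> y \<otimes> b \<in> ideal_combinations J B"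
  shows "y \<in> int_closure R J"
proof -
  have "\<exists>\<mu>. (\<forall>c\<in>B. \<mu> c \<in> J) \<and> y \<otimes> b = finsum R (\<lambda>c. \<mu> c \<otimes> c) B" if "b \<in> B" for b
    using comb[OF that] unfolding ideal_combinations_def by blast
  then obtain \<mu> where \<mu>: "\<And>b c. b \<in> B \<Longrightarrow> c \<in> B \<Longrightarrow> \<mu> b c \<in> J"
      "\<And>b. b \<in> B \<Longrightarrow> y \<otimes> b = finsum R (\<lambda>c. \<mu> b c \<otimes> c) B"
    by metis
  have \<mu>c: "\<mu> b c \<in> carrier R" if "b \<in> B" "c \<in> B" for b c using ideal.Icarr[OF J \<mu>(1)[OF that]] .
  have \<mu>L: "\<mu> b c \<in> lower_terms R J y 1" if "b \<in> B" "c \<in> B" for b c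
    using lower_of_ideal_pow[OF J y, of "\<mu> b c" 0] ideal_pow_1I[OF J \<mu>(1)[OF that]] by simp
  define M where "M b c = (if b = c then y else \<zero>) \<ominus> \<mu> b c" for b c
  have B_eq: "insert t (B - {t}) = B" using t by auto
  have "y [^] (1::nat) \<oplus> \<zero> \<in> monic_terms R J y 1"
    by (rule monicI[OF J y ideal_zero[OF lower_ideal[OF J y]]])
  then have yM: "y \<in> monic_terms R J y 1" using y by simp
  have "\<exists>N\<ge>1. \<exists>\<theta>\<in>monic_terms R J y N. \<theta> \<otimes> t = \<zero>"
  proof (rule eliminate_monic_system[OF J y, of "B - {t}" t 1 "\<lambda>b. b" M, unfolded B_eq])
    show "M i i \<in> monic_terms R J y 1" if "i \<in> B" for i
      using monic_minus_lower[OF J y yM \<mu>L[OF that that]] by (simp add: M_def)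
    show "M i j \<in> lower_terms R J y 1" if "i \<in> B" "j \<in> B" "i \<noteq> j" for i j
      using ideal_minus[OF lower_ideal[OF J y] ideal_zero[OF lower_ideal[OF J y]] \<mu>L[OF that(1,2)]] that(3)
      by (simp add: M_def)
    show "finsum R (\<lambda>j. M i j \<otimes> j) B = \<zero>" if i: "i \<in> B" for i
    proof -
      have "finsum R (\<lambda>j. M i j \<otimes> j) B = finsum R (\<lambda>j. (if i = j then y \<otimes> j else \<zero>) \<oplus> (\<ominus> \<one>) \<otimes> (\<mu> i j \<otimes> j)) B"
      proof (rule finsum_cong')
        fix j assume j: "j \<in> B"
        have c: "j \<in> carrier R" "\<mu> i j \<in> carrier R" using j B \<mu>c[OF i j] by auto
        have "(y \<ominus> \<mu> i j) \<otimes> j = y \<otimes> j \<oplus> (\<ominus> \<one>) \<otimes> (\<mu> i j \<otimes> j)" using c y by algebra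
        moreover have "(\<zero> \<ominus> \<mu> i j) \<otimes> j = \<zero> \<oplus> (\<ominus> \<one>) \<otimes> (\<mu> i j \<otimes> j)" using c y by algebra
        ultimately show "M i j \<otimes> j = (if i = j then y \<otimes> j else \<zero>) \<oplus> (\<ominus> \<one>) \<otimes> (\<mu> i j \<otimes> j)"
          unfolding M_def by (cases "i = j") auto
      qed (use B y \<mu>c i in auto)
      also have "\<dots> = finsum R (\<lambda>j. if i = j then y \<otimes> j else \<zero>) B \<oplus> finsum R (\<lambda>j. (\<ominus> \<one>) \<otimes> (\<mu> i j \<otimes> j)) B"
        by (rule finsum_addf) (use B y \<mu>c i in auto)
      also have "finsum R (\<lambda>j. if i = j then y \<otimes> j else \<zero>) B = y \<otimes> i"
        using i B y by (intro finsum_singleton) auto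
      also have "finsum R (\<lambda>j. (\<ominus> \<one>) \<otimes> (\<mu> i j \<otimes> j)) B = (\<ominus> \<one>) \<otimes> (y \<otimes> i)"
        unfolding \<mu>(2)[OF i] by (rule finsum_rdistr[symmetric]) (use B y \<mu>c i in auto)
      also have "y \<otimes> i \<oplus> (\<ominus> \<one>) \<otimes> (y \<otimes> i) = \<zero>"
        using B i y by (simp add: l_minus r_neg subset_iff)
      finally show ?thesis .
    qed
  qed (use B in auto)
  then obtain N \<theta> where N: "1 \<le> N" "\<theta> \<in> monic_terms R J y N" "\<theta> \<otimes> t = \<zero>" by blast
  have "\<theta> = \<zero>" using integral[OF N(3) monic_carrier[OF J y N(2)]] t B by auto
  then show ?thesis using int_closure_of_monic_zero[OF J y _ N(1)] N(2) by simp
qed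

section \<open>Monomials in dilated Newton polyhedra are integral\<close>

text \<open>The dilation factor is the total mass of the coefficients and not a scalar applied to a
  polyhedron: factors add along with exponents, and the factor zero requires no division.
  Coordinates from \<open>d\<close> on are unconstrained.\<close>

definition dilated_exponents :: "nat \<Rightarrow> (nat \<Rightarrow> nat) set \<Rightarrow> real \<Rightarrow> (nat \<Rightarrow> nat) set" where
  "dilated_exponents d A c = {e. \<exists>lam. (\<forall>a\<in>A. 0 \<le> lam a) \<and> (\<Sum>a\<in>A. lam a) = c \<and>
     (\<forall>i<d. (\<Sum>a\<in>A. lam a * real (a i)) \<le> real (e i))}"

lemma dilated_exponentsI:
  assumes "\<And>a. a \<in> A \<Longrightarrow> 0 \<le> lam a" "(\<Sum>a\<in>A. lam a) = c"
    "\<And>i. i < d \<Longrightarrow> (\<Sum>a\<in>A. lam a * real (a i)) \<le> real (e i)"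
  shows "e \<in> dilated_exponents d A c"
  unfolding dilated_exponents_def using assms by blast

lemma dilated_exponentsE:
  assumes "e \<in> dilated_exponents d A c"
  obtains lam where "\<And>a. a \<in> A \<Longrightarrow> 0 \<le> lam a" "(\<Sum>a\<in>A. lam a) = c"
    "\<And>i. i < d \<Longrightarrow> (\<Sum>a\<in>A. lam a * real (a i)) \<le> real (e i)"
  using assms unfolding dilated_exponents_def by blast

lemma dilated_exponents_add:
  assumes "e \<in> dilated_exponents d A c" "f \<in> dilated_exponents d A c'"
  shows "(\<lambda>i. e i + f i) \<in> dilated_exponents d A (c + c')"
proof -
  obtain lam where lam: "\<And>a. a \<in> A \<Longrightarrow> 0 \<le> lam a" "(\<Sum>a\<in>A. lam a) = c"
    "\<And>i. i < d \<Longrightarrow> (\<Sum>a\<in>A. lam a * real (a i)) \<le> real (e i)" using dilated_exponentsE[OF assms(1)] by blast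
  obtain lam' where lam': "\<And>a. a \<in> A \<Longrightarrow> 0 \<le> lam' a" "(\<Sum>a\<in>A. lam' a) = c'"
    "\<And>i. i < d \<Longrightarrow> (\<Sum>a\<in>A. lam' a * real (a i)) \<le> real (f i)" using dilated_exponentsE[OF assms(2)] by blast
  show ?thesis
    using lam lam' by (intro dilated_exponentsI[of A "\<lambda>a. lam a + lam' a"])
      (auto simp: sum.distrib distrib_right intro: add_mono)
qed

text \<open>Rounded coefficients may sum to more than \<open>p\<close>; this trims them to the exact
  exponent of the ideal power.\<close>

lemma exists_le_sum_eq:
  fixes n :: "'c \<Rightarrow> nat"
  assumes "finite A"
  shows "p \<le> (\<Sum>a\<in>A. n a) \<Longrightarrow> \<exists>\<nu>. (\<forall>a\<in>A. \<nu> a \<le> n a) \<and> (\<Sum>a\<in>A. \<nu> a) = p"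
proof (induction p)
  case 0 then show ?case by (intro exI[of _ "\<lambda>_. 0"]) simp
next
  case (Suc p)
  then obtain \<nu> where \<nu>: "\<forall>a\<in>A. \<nu> a \<le> n a" "(\<Sum>a\<in>A. \<nu> a) = p" by auto
  have "\<exists>a\<in>A. \<nu> a < n a"
  proof (rule ccontr)
    assume "\<not> (\<exists>a\<in>A. \<nu> a < n a)"
    then have "(\<Sum>a\<in>A. n a) \<le> (\<Sum>a\<in>A. \<nu> a)" by (intro sum_mono) (auto simp: not_less)
    then show False using \<nu>(2) Suc.prems by simp
  qed
  then obtain b where b: "b \<in> A" "\<nu> b < n b" by blast
  have "(\<Sum>a\<in>A. (\<nu>(b := Suc (\<nu> b))) a) = Suc p"
    using \<nu>(2) b(1) assms by (simp add: sum.remove[of A b] cong: sum.cong_simp)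
  then show ?case using \<nu>(1) b by (intro exI[of _ "\<nu>(b := Suc (\<nu> b))"]) auto
qed

text \<open>Rounding the coefficients down loses less than one per vertex, so a dilation factor of at least
  \<open>card A\<close> leaves enough room to split off integral multiples of the vertices.\<close>

lemma dilated_exponents_split:
  assumes fin: "finite A" and v: "v \<in> dilated_exponents d A (real (card A + p))"
  obtains \<nu> \<theta> where "(\<Sum>a\<in>A. \<nu> a) = p" "\<theta> \<in> dilated_exponents d A (real (card A))"
    "\<And>i. i < d \<Longrightarrow> v i = (\<Sum>a\<in>A. \<nu> a * a i) + \<theta> i"
proof -
  obtain lam where lam: "\<And>a. a \<in> A \<Longrightarrow> 0 \<le> lam a" "(\<Sum>a\<in>A. lam a) = real (card A + p)"
    "\<And>i. i < d \<Longrightarrow> (\<Sum>a\<in>A. lam a * real (a i)) \<le> real (v i)" using dilated_exponentsE[OF v] by blast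
  define n where "n a = nat \<lfloor>lam a\<rfloor>" for a
  have n: "real (n a) \<le> lam a" "lam a \<le> real (n a) + 1" if "a \<in> A" for a
    using lam(1)[OF that] unfolding n_def by (auto simp: of_nat_nat floor_le_iff)
  have "real (card A + p) \<le> (\<Sum>a\<in>A. real (n a) + 1)" unfolding lam(2)[symmetric] by (rule sum_mono) (rule n(2))
  also have "\<dots> = real ((\<Sum>a\<in>A. n a) + card A)" by (simp add: sum.distrib)
  finally have "p \<le> (\<Sum>a\<in>A. n a)" by linarith
  then obtain \<nu> where \<nu>: "\<forall>a\<in>A. \<nu> a \<le> n a" "(\<Sum>a\<in>A. \<nu> a) = p" using exists_le_sum_eq[OF fin] by blast
  have \<nu>_le: "real (\<nu> a) \<le> lam a" if "a \<in> A" for a using n(1)[OF that] \<nu>(1) that by fastforce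
  have le: "(\<Sum>a\<in>A. \<nu> a * a i) \<le> v i" if "i < d" for i
  proof -
    have "real (\<Sum>a\<in>A. \<nu> a * a i) \<le> (\<Sum>a\<in>A. lam a * real (a i))"
      unfolding of_nat_sum of_nat_mult by (intro sum_mono mult_right_mono \<nu>_le) auto
    then show ?thesis using lam(3)[OF that] by linarith
  qed
  \<comment> \<open>The leftover has coefficients \<open>lam a - real (\<nu> a)\<close>, which are
    nonnegative and sum to \<open>card A\<close>.\<close>
  define \<theta> where "\<theta> i = v i - (\<Sum>a\<in>A. \<nu> a * a i)" for i
  have "\<theta> \<in> dilated_exponents d A (real (card A))"
  proof (rule dilated_exponentsI[of A "\<lambda>a. lam a - real (\<nu> a)"])
    have "(\<Sum>a\<in>A. lam a - real (\<nu> a)) = real (card A + p) - real p"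
      unfolding sum_subtractf lam(2) using \<nu>(2) by (metis of_nat_sum)
    then show "(\<Sum>a\<in>A. lam a - real (\<nu> a)) = real (card A)" by simp
    fix i assume i: "i < d"
    have "(\<Sum>a\<in>A. (lam a - real (\<nu> a)) * real (a i)) = (\<Sum>a\<in>A. lam a * real (a i)) - real (\<Sum>a\<in>A. \<nu> a * a i)"
      by (simp add: left_diff_distrib sum_subtractf)
    also have "\<dots> \<le> real (v i) - real (\<Sum>a\<in>A. \<nu> a * a i)" using lam(3)[OF i] by linarith
    also have "\<dots> = real (\<theta> i)" unfolding \<theta>_def using le[OF i] by (rule of_nat_diff[symmetric])
    finally show "(\<Sum>a\<in>A. (lam a - real (\<nu> a)) * real (a i)) \<le> real (\<theta> i)" .
  qed (use \<nu>_le in auto)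
  moreover have "v i = (\<Sum>a\<in>A. \<nu> a * a i) + \<theta> i" if "i < d" for i
    unfolding \<theta>_def using le[OF that] by simp
  ultimately show thesis using that \<nu>(2) by blast
qed

lemma dilated_exponents_nonempty:
  assumes "finite A" "A \<noteq> {}" shows "dilated_exponents d A (real s) \<noteq> {}"
proof -
  obtain b where b: "b \<in> A" using assms by blast
  have "(\<lambda>i. s * b i) \<in> dilated_exponents d A (real s)"
    by (rule dilated_exponentsI[of A "\<lambda>a. if a = b then real s else 0"])
      (use assms b in \<open>auto simp: if_distrib[where f = "\<lambda>z. z * _"] sum.delta cong: if_cong\<close>)
  then show ?thesis by blast
qed

context monomial_system
begin

lemma mon_neq_zero: "mon e \<noteq> \<zero>"
  using mon_notin_mon_ideal[of "{}" e] ideal_zero[OF mon_ideal_ideal[of "{}"]] by fastforce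

lemma mon_sum_in_ideal_pow:
  assumes fin: "finite A"
  shows "(\<Sum>a\<in>A. \<nu> a) = p \<Longrightarrow> mon (\<lambda>i. \<Sum>a\<in>A. \<nu> a * a i) \<in> ideal_pow R (mon_ideal A) p"
proof (induction p arbitrary: \<nu>)
  case 0 then show ?case by simp
next
  case (Suc p)
  then obtain b where b: "b \<in> A" "\<nu> b \<noteq> 0" by (metis nat.distinct(1) sum.neutral)
  define \<nu>' where "\<nu>' = \<nu>(b := \<nu> b - 1)"
  have "(\<Sum>a\<in>A. \<nu>' a) = p"
    using Suc.prems b fin unfolding \<nu>'_def by (simp add: sum.remove[of A b] cong: sum.cong_simp)
  then have "mon (\<lambda>i. \<Sum>a\<in>A. \<nu>' a * a i) \<in> ideal_pow R (mon_ideal A) p" by (rule Suc.IH)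
  moreover have "mon b \<in> mon_ideal A" by (rule mon_in_mon_ideal[OF b(1)]) simp
  ultimately have "mon b \<otimes> mon (\<lambda>i. \<Sum>a\<in>A. \<nu>' a * a i) \<in> ideal_pow R (mon_ideal A) (Suc p)"
    by (simp add: ideal_prod.prod)
  moreover have "(\<lambda>i. b i + (\<Sum>a\<in>A. \<nu>' a * a i)) = (\<lambda>i. \<Sum>a\<in>A. \<nu> a * a i)"
  proof
    fix i
    have "\<nu> b * b i = b i + (\<nu> b - 1) * b i" using b(2) by (cases "\<nu> b") auto
    then show "b i + (\<Sum>a\<in>A. \<nu>' a * a i) = (\<Sum>a\<in>A. \<nu> a * a i)"
      unfolding \<nu>'_def using b(1) fin by (simp add: sum.remove[of A b] cong: sum.cong_simp)
  qed
  ultimately show ?case by (simp flip: mon_add)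
qed

text \<open>Stated for an additive family \<open>K\<close> because it serves both the dilated
  exponents and the weight filtration.\<close>

lemma mon_ideal_pow:
  assumes add: "\<And>c c' e f. e \<in> K c \<Longrightarrow> f \<in> K c' \<Longrightarrow> (\<lambda>i. e i + f i) \<in> K (c + c')"
    and zero: "(\<lambda>_. 0) \<in> K (0::real)" and r: "r \<in> mon_ideal (K c)"
  shows "r [^] k \<in> mon_ideal (K (real k * c))"
proof (induction k)
  case 0
  then show ?case using mon_in_mon_ideal[OF zero, of "\<lambda>_. 0"] by (simp add: mon_zero)
next
  case (Suc k)
  have "r [^] k \<otimes> r \<in> mon_ideal (K (real (Suc k) * c))"
  proof (rule mult_Idl_Idl[OF mon_image_closed mon_image_closed mon_ideal_ideal _ Suc r])
    fix a b assume "a \<in> mon ` K (real k * c)" "b \<in> mon ` K c"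
    then obtain e f where ef: "e \<in> K (real k * c)" "f \<in> K c" "a = mon e" "b = mon f" by blast
    have "(\<lambda>i. e i + f i) \<in> K (real (Suc k) * c)" using add[OF ef(1,2)] by (simp add: distrib_right add.commute)
    then show "a \<otimes> b \<in> mon_ideal (K (real (Suc k) * c))"
      unfolding ef(3,4) mon_add[symmetric] by (rule mon_in_mon_ideal) simp
  qed
  then show ?case by simp
qed

lemma dilated_integral:
  assumes fin: "finite A" "A \<noteq> {}" and y: "y \<in> mon_ideal (dilated_exponents d A (real p))"
  shows "y \<in> int_closure R (ideal_pow R (mon_ideal A) p)"
proof -
  let ?J = "ideal_pow R (mon_ideal A) p" and ?H = "mon_ideal (dilated_exponents d A (real (card A)))"
  have J: "ideal ?J R" by (rule ideal_pow_ideal) simp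
  have yc: "y \<in> carrier R" by (rule mon_ideal_carrier[OF y])
  \<comment> \<open>The generators in \<open>B\<close> need not be monomials, so products of
    monomials are re-expanded over \<open>B\<close> below.\<close>
  obtain B where B: "B \<subseteq> carrier R" "finite B" "?H = Idl B" using finetely_gen[OF mon_ideal_ideal] by metis
  have C: "ideal (ideal_combinations ?J B) R" by (rule ideal_combinations_ideal[OF J B(1,2)])
  have prod: "y \<otimes> h \<in> ideal_combinations ?J B" if h: "h \<in> ?H" for h
  proof (rule mult_Idl_Idl[OF mon_image_closed mon_image_closed C _ y h])
    fix a b
    assume "a \<in> mon ` dilated_exponents d A (real p)" "b \<in> mon ` dilated_exponents d A (real (card A))"
    then obtain e f where ef: "e \<in> dilated_exponents d A (real p)" "f \<in> dilated_exponents d A (real (card A))"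
      "a = mon e" "b = mon f" by blast
    have "(\<lambda>i. e i + f i) \<in> dilated_exponents d A (real (card A + p))"
      using dilated_exponents_add[OF ef(1,2)] by (simp add: add.commute)
    then obtain \<nu> \<theta> where s: "(\<Sum>a\<in>A. \<nu> a) = p" "\<theta> \<in> dilated_exponents d A (real (card A))"
      "\<And>i. i < d \<Longrightarrow> e i + f i = (\<Sum>a\<in>A. \<nu> a * a i) + \<theta> i"
      using dilated_exponents_split[OF fin(1), of "\<lambda>i. e i + f i" d p] by blast
    have "a \<otimes> b = mon (\<lambda>i. (\<Sum>a\<in>A. \<nu> a * a i) + \<theta> i)"
      unfolding ef(3,4) mon_add[symmetric] by (rule mon_cong) (rule s(3))
    also have "\<dots> = mon (\<lambda>i. \<Sum>a\<in>A. \<nu> a * a i) \<otimes> mon \<theta>" by (rule mon_add)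
    also have "\<dots> \<in> ideal_combinations ?J B"
    proof (rule mult_Idl_in_ideal_combinations[OF J B(1,2) mon_sum_in_ideal_pow[OF fin(1) s(1)]])
      show "mon \<theta> \<in> Idl B" unfolding B(3)[symmetric] by (rule mon_in_mon_ideal[OF s(2)]) simp
    qed
    finally show "a \<otimes> b \<in> ideal_combinations ?J B" .
  qed
  obtain \<theta> where \<theta>: "\<theta> \<in> dilated_exponents d A (real (card A))" using dilated_exponents_nonempty[OF fin] by blast
  have "\<exists>t\<in>B. t \<noteq> \<zero>"
  proof (rule ccontr)
    assume "\<not> (\<exists>t\<in>B. t \<noteq> \<zero>)"
    then have "Idl B \<subseteq> {\<zero>}" by (intro Idl_subsetI zeroideal) auto
    then have "mon \<theta> = \<zero>" using mon_in_mon_ideal[OF \<theta>, of \<theta>] B(3) by auto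
    then show False using mon_neq_zero by simp
  qed
  then obtain t where t: "t \<in> B" "t \<noteq> \<zero>" by blast
  have "B \<subseteq> ?H" unfolding B(3) by (rule genideal_self[OF B(1)])
  then show ?thesis using prod by (intro determinant_trick[OF J yc B(1,2) t]) blast
qed

lemma dilated_in_rational_power:
  assumes fin: "finite A" "A \<noteq> {}" and q: "0 < q"
    and r: "r \<in> mon_ideal (dilated_exponents d A (real p / real q))"
  shows "r [^] q \<in> int_closure R (ideal_pow R (mon_ideal A) p)"
proof -
  have "(\<lambda>_. 0) \<in> dilated_exponents d A 0" by (rule dilated_exponentsI[of A "\<lambda>_. 0"]) auto
  then have "r [^] q \<in> mon_ideal (dilated_exponents d A (real q * (real p / real q)))"
    using mon_ideal_pow[where K = "dilated_exponents d A", OF dilated_exponents_add _ r] by blast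
  then show ?thesis using dilated_integral[OF fin] q by simp
qed

end

section \<open>Generic separating weights\<close>

text \<open>Coefficient functions are forced to vanish off \<open>A\<close>, so that Tychonoff's
  theorem applies in the product topology on the full function space.\<close>

lemma compact_simplex:
  fixes A :: "'c set"
  assumes "finite A"
  shows "compact {lam :: 'c \<Rightarrow> real. (\<forall>a. lam a \<in> (if a \<in> A then {0..1} else {0})) \<and> (\<Sum>a\<in>A. lam a) = 1}"
proof -
  let ?B = "\<lambda>a. if a \<in> A then {0..1} else {0} :: real set"
  have "compact (PiE UNIV ?B)"
    using compactin_PiE[of "\<lambda>_. euclidean" UNIV ?B]
    by (auto simp: euclidean_product_topology compactin_euclidean_iff)
  moreover have "closed {lam :: 'c \<Rightarrow> real. (\<Sum>a\<in>A. lam a) = 1}"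
    by (intro closed_Collect_eq continuous_intros) (auto intro: continuous_on_product_coordinates)
  ultimately have "compact (PiE UNIV ?B \<inter> {lam. (\<Sum>a\<in>A. lam a) = 1})" by (rule compact_Int_closed)
  moreover have "PiE UNIV ?B \<inter> {lam. (\<Sum>a\<in>A. lam a) = 1}
      = {lam. (\<forall>a. lam a \<in> ?B a) \<and> (\<Sum>a\<in>A. lam a) = 1}" unfolding PiE_UNIV_domain Pi_def by blast
  ultimately show ?thesis by simp
qed

text \<open>The first-order condition at a minimum: \<open>2 * p\<close> is the slope at zero of the
  quadratic.\<close>

lemma nonneg_of_quadratic:
  fixes p q :: real
  assumes "\<And>t. 0 < t \<Longrightarrow> t \<le> 1 \<Longrightarrow> 0 \<le> 2 * t * p + t\<^sup>2 * q" "0 \<le> q"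
  shows "0 \<le> p"
proof (rule ccontr)
  assume "\<not> 0 \<le> p"
  \<comment> \<open>Small enough that \<open>t * q\<close> is at most \<open>- p\<close>; the
    \<open>+ 1\<close> avoids a zero denominator.\<close>
  define t where "t = min 1 (- p / (q + 1))"
  have t: "0 < t" "t \<le> 1" using \<open>\<not> 0 \<le> p\<close> assms(2) by (auto simp: t_def divide_neg_pos)
  have "t * q \<le> (- p / (q + 1)) * q" unfolding t_def using assms(2) by (intro mult_right_mono) auto
  also have "\<dots> \<le> - p" using \<open>\<not> 0 \<le> p\<close> assms(2) by (simp add: field_simps)
  finally have "2 * p + t * q < 0" using \<open>\<not> 0 \<le> p\<close> by linarith
  then have "t * (2 * p + t * q) < 0" using t(1) by (simp add: mult_pos_neg)
  then show False using assms(1)[OF t] by (simp add: power2_eq_square algebra_simps)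
qed

text \<open>Ville's alternative: minimise the squared distance of \<open>\<Sum>a\<in>A. lam a * v a\<close> to the negative orthant over
  the simplex; the residual at the minimiser is the separating functional.\<close>

lemma Ville_alternative:
  fixes v :: "'c \<Rightarrow> nat \<Rightarrow> real"
  assumes fin: "finite A" "A \<noteq> {}"
    and none: "\<And>lam. (\<forall>a\<in>A. 0 \<le> lam a) \<Longrightarrow> (\<Sum>a\<in>A. lam a) = 1 \<Longrightarrow> \<exists>i<d. 0 < (\<Sum>a\<in>A. lam a * v a i)"
  obtains l where "\<And>i. 0 \<le> l i" "\<And>a. a \<in> A \<Longrightarrow> 0 < (\<Sum>i<d. l i * v a i)"
proof -
  define S where "S = {lam. (\<forall>a. lam a \<in> (if a \<in> A then {0..1} else {0 :: real})) \<and> (\<Sum>a\<in>A. lam a) = 1}"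
  define y where "y lam i = (\<Sum>a\<in>A. lam a * v a i)" for lam i
  define \<phi> where "\<phi> lam = (\<Sum>i<d. (max 0 (y lam i))\<^sup>2)" for lam
  obtain a0 where a0: "a0 \<in> A" using fin by blast
  have vertex: "(\<lambda>a. if a = b then 1 else 0) \<in> S" if "b \<in> A" for b
    using that fin(1) by (auto simp: S_def)
  have "continuous_on S \<phi>"
    unfolding \<phi>_def y_def by (intro continuous_intros continuous_on_subset[OF continuous_on_product_coordinates]) auto
  moreover have "compact S" unfolding S_def by (rule compact_simplex[OF fin(1)])
  ultimately obtain lam where lam: "lam \<in> S" "\<And>mu. mu \<in> S \<Longrightarrow> \<phi> lam \<le> \<phi> mu"
    using continuous_attains_inf[of S \<phi>] vertex[OF a0] by blast
  define l where "l i = max 0 (y lam i)" for i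
  have lam_nn: "\<forall>a\<in>A. 0 \<le> lam a" using lam(1) by (auto simp: S_def split: if_splits)
  have lam_sum: "(\<Sum>a\<in>A. lam a) = 1" using lam(1) by (simp add: S_def)
  have key: "0 \<le> (\<Sum>i<d. l i * (v b i - y lam i))" if b: "b \<in> A" for b
  proof (rule nonneg_of_quadratic)
    let ?h = "\<lambda>i. v b i - y lam i"
    show "0 \<le> (\<Sum>i<d. (?h i)\<^sup>2)" by (intro sum_nonneg) auto
    fix t :: real assume t: "0 < t" "t \<le> 1"
    \<comment> \<open>Moves from the minimiser towards the point mass at \<open>b\<close>, inside
      the simplex because \<open>t \<le> 1\<close>.\<close>
    define mu where "mu a = (1 - t) * lam a + t * (if a = b then 1 else 0)" for a
    have "mu \<in> S"
    proof -
      have "mu a \<in> (if a \<in> A then {0..1} else {0})" for a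
      proof -
        have "lam a \<in> (if a \<in> A then {0..1} else {0})" using lam(1) by (auto simp: S_def)
        moreover from this have "(1 - t) * lam a \<le> 1 - t"
          using t(2) by (intro mult_left_le) (auto split: if_splits)
        ultimately show ?thesis
          using t b unfolding mu_def by (cases "a \<in> A") auto
      qed
      moreover have "(\<Sum>a\<in>A. mu a) = 1"
        unfolding mu_def using lam_sum b fin(1) by (simp add: sum.distrib flip: sum_distrib_left)
      ultimately show ?thesis by (simp add: S_def)
    qed
    then have "\<phi> lam \<le> \<phi> mu" by (rule lam(2))
    also have "\<dots> \<le> (\<Sum>i<d. (l i + t * ?h i)\<^sup>2)"
      unfolding \<phi>_def
    proof (rule sum_mono)
      fix i
      have "y mu i = (\<Sum>a\<in>A. (1 - t) * (lam a * v a i) + t * ((if a = b then 1 else 0) * v a i))"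
        unfolding y_def mu_def by (rule sum.cong) (auto simp: algebra_simps)
      also have "\<dots> = (1 - t) * y lam i + t * v b i"
        unfolding y_def sum.distrib using b fin(1)
        by (simp add: if_distrib[where f = "\<lambda>z. z * _"] flip: sum_distrib_left cong: if_cong)
      finally have "y mu i = y lam i + t * ?h i" by (simp add: algebra_simps)
      \<comment> \<open>\<open>l\<close> dominates \<open>y lam\<close>, and the square absorbs the
        truncation. The resulting quadratic in \<open>t\<close> bounds \<open>\<phi> mu\<close> and
        equals \<open>\<phi> lam\<close> at \<open>t = 0\<close>.\<close>
      then have "max 0 (y mu i) \<le> \<bar>l i + t * ?h i\<bar>" unfolding l_def by linarith
      then show "(max 0 (y mu i))\<^sup>2 \<le> (l i + t * ?h i)\<^sup>2"
        by (metis abs_ge_zero max.cobounded1 power2_abs power_mono)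
    qed
    also have "\<dots> = (\<Sum>i<d. (l i)\<^sup>2) + (2 * t * (\<Sum>i<d. l i * ?h i) + t\<^sup>2 * (\<Sum>i<d. (?h i)\<^sup>2))"
      unfolding sum_distrib_left sum.distrib[symmetric]
      by (rule sum.cong) (auto simp: power2_eq_square algebra_simps)
    finally show "0 \<le> 2 * t * (\<Sum>i<d. l i * ?h i) + t\<^sup>2 * (\<Sum>i<d. (?h i)\<^sup>2)"
      by (simp add: \<phi>_def l_def)
  qed
  obtain i0 where i0: "i0 < d" "0 < y lam i0" using none[OF lam_nn lam_sum] unfolding y_def by blast
  \<comment> \<open>As \<open>l\<close> is the positive part of \<open>y lam\<close>, this sum is
    the squared distance at the minimiser, and \<open>none\<close> keeps it from vanishing.\<close>
  have "0 < (\<Sum>i<d. l i * y lam i)"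
    by (rule sum_pos2[of _ i0]) (use i0 in \<open>auto simp: l_def max_def\<close>)
  then have "0 < (\<Sum>i<d. l i * v b i)" if "b \<in> A" for b
    using key[OF that] by (simp add: right_diff_distrib sum_subtractf)
  then show thesis using that[of l] by (auto simp: l_def)
qed

section \<open>Weights that are injective on exponents\<close>

lemma countable_finite_support: "countable {e :: nat \<Rightarrow> nat. \<forall>i\<ge>d. e i = 0}"
proof (rule countable_subset)
  show "{e :: nat \<Rightarrow> nat. \<forall>i\<ge>d. e i = 0} \<subseteq> (\<lambda>f i. if i < d then f i else 0) ` (PiE {..<d} (\<lambda>_. UNIV))"
  proof
    fix e :: "nat \<Rightarrow> nat" assume "e \<in> {e. \<forall>i\<ge>d. e i = 0}"
    then have "e = (\<lambda>i. if i < d then restrict e {..<d} i else 0)" by (auto simp: fun_eq_iff not_less)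
    then show "e \<in> (\<lambda>f i. if i < d then f i else 0) ` (PiE {..<d} (\<lambda>_. UNIV))"
      by (intro image_eqI[of _ _ "restrict e {..<d}"]) auto
  qed
  show "countable ((\<lambda>f i. if i < d then f i else 0 :: nat) ` (PiE {..<d} (\<lambda>_. UNIV)))"
    by (intro countable_image countable_PiE) auto
qed

text \<open>Perturbing along the moment curve makes the weights injective on exponents: each coincidence is a
  nontrivial polynomial equation in \<open>t\<close>.\<close>

lemma exists_injective_perturbation:
  fixes l :: "nat \<Rightarrow> real"
  assumes "0 < \<delta>"
  obtains t where "0 < t" "t < \<delta>"
    "\<And>e f :: nat \<Rightarrow> nat. (\<Sum>i<d. (l i + t ^ Suc i) * real (e i)) = (\<Sum>i<d. (l i + t ^ Suc i) * real (f i)) \<Longrightarrow>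
       \<forall>i<d. e i = f i"
proof -
  let ?E = "{e :: nat \<Rightarrow> nat. \<forall>i\<ge>d. e i = 0}"
  define Z where "Z e f = {t. (\<Sum>i<d. (l i + t ^ Suc i) * real (e i)) = (\<Sum>i<d. (l i + t ^ Suc i) * real (f i))}"
    for e f :: "nat \<Rightarrow> nat"
  have finZ: "finite (Z e f)" if ef: "i < d" "e i \<noteq> f i" for e f i
  proof -
    \<comment> \<open>The coefficients of the difference as a polynomial in \<open>t\<close>:
      \<open>l\<close> enters only the constant term, and each coordinate has its own power of
      \<open>t\<close>.\<close>
    define c where "c j = (case j of 0 \<Rightarrow> (\<Sum>i<d. l i * (real (e i) - real (f i))) | Suc i \<Rightarrow> real (e i) - real (f i))" for j
    have "(\<Sum>j\<le>d. c j * t ^ j) = (\<Sum>i<d. (l i + t ^ Suc i) * real (e i)) - (\<Sum>i<d. (l i + t ^ Suc i) * real (f i))" for t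
    proof -
      have "(\<Sum>j\<le>d. c j * t ^ j) = c 0 + (\<Sum>i<d. c (Suc i) * t ^ Suc i)"
        unfolding lessThan_Suc_atMost[symmetric] by (subst sum.lessThan_Suc_shift) simp
      also have "\<dots> = (\<Sum>i<d. l i * (real (e i) - real (f i)) + (real (e i) - real (f i)) * t ^ Suc i)"
        unfolding sum.distrib by (simp add: c_def)
      also have "\<dots> = (\<Sum>i<d. (l i + t ^ Suc i) * real (e i) - (l i + t ^ Suc i) * real (f i))"
        by (rule sum.cong) (auto simp: algebra_simps)
      finally show ?thesis by (simp add: sum_subtractf)
    qed
    then have "Z e f = {t. (\<Sum>j\<le>d. c j * t ^ j) = 0}" unfolding Z_def by auto
    moreover have "c (Suc i) \<noteq> 0" using ef by (simp add: c_def)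
    ultimately show ?thesis using polyfun_finite_roots[of c d] ef(1) by (metis Suc_leI)
  qed
  \<comment> \<open>Cutting exponents off at \<open>d\<close> leaves countably many pairs, each
    excluding finitely many \<open>t\<close>.\<close>
  define bad where "bad = (\<Union>(e, f)\<in>{(e, f). e \<in> ?E \<and> f \<in> ?E \<and> e \<noteq> f}. Z e f)"
  have "countable {(e, f). e \<in> ?E \<and> f \<in> ?E \<and> e \<noteq> f}"
    by (rule countable_subset[of _ "?E \<times> ?E"]) (auto intro!: countable_SIGMA countable_finite_support)
  moreover have "finite (Z e f)" if "e \<in> ?E" "f \<in> ?E" "e \<noteq> f" for e f
  proof -
    obtain i where "e i \<noteq> f i" using \<open>e \<noteq> f\<close> by blast
    moreover have "e j = f j" if "\<not> j < d" for j using \<open>e \<in> ?E\<close> \<open>f \<in> ?E\<close> that by simp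
    ultimately show ?thesis using finZ[of i e f] by blast
  qed
  ultimately have "countable bad" unfolding bad_def by (intro countable_UN) (auto intro: countable_finite)
  moreover have "uncountable {0<..<\<delta>}" using assms by (simp add: uncountable_open_interval)
  ultimately obtain t where t: "t \<in> {0<..<\<delta>}" "t \<notin> bad"
    using countable_subset[of "{0<..<\<delta>}" bad] by blast
  show thesis
  proof (rule that[of t])
    fix e f :: "nat \<Rightarrow> nat"
    assume eq: "(\<Sum>i<d. (l i + t ^ Suc i) * real (e i)) = (\<Sum>i<d. (l i + t ^ Suc i) * real (f i))"
    define e' where "e' i = (if i < d then e i else 0)" for i
    define f' where "f' i = (if i < d then f i else 0)" for i
    have "t \<in> Z e' f'" using eq by (simp add: Z_def e'_def f'_def)
    moreover have "e' \<in> ?E" "f' \<in> ?E" by (auto simp: e'_def f'_def)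
    ultimately have "e' = f'" using t(2) unfolding bad_def by blast
    then show "\<forall>i<d. e i = f i" unfolding e'_def f'_def by (metis (full_types))
  qed (use t in auto)
qed

text \<open>Ville's alternative for the vectors \<open>v a\<close> gives nonnegative weights with
  strict inequalities. There are finitely many vertices, so these survive a small perturbation,
  which also makes the weights positive.\<close>

lemma exists_generic_weights:
  fixes b :: "nat \<Rightarrow> nat"
  assumes fin: "finite A" "A \<noteq> {}" and w: "0 < w" and b: "b \<notin> dilated_exponents d A w"
  obtains l :: "nat \<Rightarrow> real" where "\<And>i. i < d \<Longrightarrow> 0 < l i"
    "\<And>e f :: nat \<Rightarrow> nat. (\<Sum>i<d. l i * real (e i)) = (\<Sum>i<d. l i * real (f i)) \<Longrightarrow> \<forall>i<d. e i = f i"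
    "\<And>a. a \<in> A \<Longrightarrow> (\<Sum>i<d. l i * real (b i)) < w * (\<Sum>i<d. l i * real (a i))"
proof -
  define v where "v a i = w * real (a i) - real (b i)" for a :: "nat \<Rightarrow> nat" and i
  have "\<exists>i<d. 0 < (\<Sum>a\<in>A. lam a * v a i)" if lam: "\<forall>a\<in>A. 0 \<le> lam a" "(\<Sum>a\<in>A. lam a) = 1" for lam
  proof (rule ccontr)
    assume neg: "\<not> (\<exists>i<d. 0 < (\<Sum>a\<in>A. lam a * v a i))"
    have "b \<in> dilated_exponents d A w"
    proof (rule dilated_exponentsI[of A "\<lambda>a. w * lam a"])
      show "(\<Sum>a\<in>A. w * lam a) = w" using lam(2) by (simp flip: sum_distrib_left)
      fix i assume "i < d"
      then have "(\<Sum>a\<in>A. lam a * v a i) \<le> 0" using neg by (meson not_less)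
      moreover have "(\<Sum>a\<in>A. lam a * v a i) = (\<Sum>a\<in>A. w * lam a * real (a i)) - (\<Sum>a\<in>A. lam a) * real (b i)"
        unfolding v_def sum_distrib_right sum_subtractf[symmetric] by (rule sum.cong) (auto simp: algebra_simps)
      ultimately show "(\<Sum>a\<in>A. w * lam a * real (a i)) \<le> real (b i)" using lam(2) by simp
    qed (use lam w in auto)
    then show False using b by simp
  qed
  then obtain l where l: "\<And>i. 0 \<le> l i" "\<And>a. a \<in> A \<Longrightarrow> 0 < (\<Sum>i<d. l i * v a i)"
    using Ville_alternative[OF fin, of d v] by blast
  define g where "g a t = (\<Sum>i<d. (l i + t ^ Suc i) * v a i)" for a t
  have "eventually (\<lambda>t. 0 < g a t) (at_right 0)" if "a \<in> A" for a
  proof -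
    have "(g a \<longlongrightarrow> g a 0) (at_right 0)" unfolding g_def by (intro tendsto_intros)
    moreover have "0 < g a 0" using l(2)[OF that] by (simp add: g_def)
    ultimately show ?thesis by (rule order_tendstoD)
  qed
  then have "eventually (\<lambda>t. \<forall>a\<in>A. 0 < g a t) (at_right 0)" using fin(1) by (intro eventually_ball_finite) auto
  then obtain \<delta> where \<delta>: "0 < \<delta>" "\<And>t. 0 < t \<Longrightarrow> t < \<delta> \<Longrightarrow> \<forall>a\<in>A. 0 < g a t"
    unfolding eventually_at_right_field by blast
  obtain t where t: "0 < t" "t < \<delta>"
    "\<And>e f :: nat \<Rightarrow> nat. (\<Sum>i<d. (l i + t ^ Suc i) * real (e i)) = (\<Sum>i<d. (l i + t ^ Suc i) * real (f i)) \<Longrightarrow>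
       \<forall>i<d. e i = f i"
    using exists_injective_perturbation[OF \<delta>(1), of l d] by blast
  show thesis
  proof (rule that[of "\<lambda>i. l i + t ^ Suc i"])
    show "0 < l i + t ^ Suc i" for i using l(1)[of i] t(1) by (intro add_nonneg_pos) auto
    fix a assume "a \<in> A"
    then have "0 < g a t" using \<delta>(2) t(1,2) by blast
    also have "g a t = w * (\<Sum>i<d. (l i + t ^ Suc i) * real (a i)) - (\<Sum>i<d. (l i + t ^ Suc i) * real (b i))"
      unfolding g_def v_def sum_distrib_left sum_subtractf[symmetric] by (rule sum.cong) (auto simp: algebra_simps)
    finally show "(\<Sum>i<d. (l i + t ^ Suc i) * real (b i)) < w * (\<Sum>i<d. (l i + t ^ Suc i) * real (a i))" by simp
  qed (rule t(3))
qed

section \<open>Integral elements have large weight\<close>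

lemma (in cring) finsum_in_ideal:
  assumes I: "ideal I R" shows "(\<And>a. a \<in> B \<Longrightarrow> g a \<in> I) \<Longrightarrow> finsum R g B \<in> I"
proof (induction B rule: infinite_finite_induct)
  case (insert b B)
  then show ?case using ideal.Icarr[OF I] ideal_add[OF I] by (subst finsum_insert) auto
qed (auto simp: ideal_zero[OF I])

lemma (in primeideal) prime_pow: "u \<in> carrier R \<Longrightarrow> u [^] (n::nat) \<in> I \<Longrightarrow> u \<in> I"
proof (induction n)
  case 0
  then show ?case using one_imp_carrier I_notcarr by simp
next
  case (Suc n)
  then show ?case using I_prime[of "u [^] n" u] by auto
qed

text \<open>Positivity makes multiplication by a parameter raise the weight and leaves finitely many
  weight values below any bound. Injectivity allows one monomial per weight.\<close>

locale weighted_monomial_system = monomial_system +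
  fixes l :: "nat \<Rightarrow> real"
  assumes l_pos: "i < d \<Longrightarrow> 0 < l i"
    and l_inj: "(\<Sum>i<d. l i * real (e i)) = (\<Sum>i<d. l i * real (f i)) \<Longrightarrow> \<forall>i<d. e i = f i"
begin

definition wt :: "(nat \<Rightarrow> nat) \<Rightarrow> real" where
  "wt e = (\<Sum>i<d. l i * real (e i))"

abbreviation filt :: "real \<Rightarrow> 'a set" where
  "filt c \<equiv> mon_ideal {e. c \<le> wt e}"

abbreviation filt_strict :: "real \<Rightarrow> 'a set" where
  "filt_strict c \<equiv> mon_ideal {e. c < wt e}"

lemma wt_add: "wt (\<lambda>i. e i + f i) = wt e + wt f"
  by (simp add: wt_def distrib_left sum.distrib)

lemma wt_zero [simp]: "wt (\<lambda>_. 0) = 0"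
  by (simp add: wt_def)

lemma wt_mult: "wt (\<lambda>i. k * e i) = real k * wt e"
  by (simp add: wt_def sum_distrib_left mult.left_commute)

lemma wt_mono: "(\<And>i. i < d \<Longrightarrow> e i \<le> f i) \<Longrightarrow> wt e \<le> wt f"
  unfolding wt_def by (intro sum_mono mult_left_mono) (auto intro: less_imp_le l_pos)

lemma wt_less_imp: "wt e < wt f \<Longrightarrow> \<exists>i<d. e i < f i"
  using wt_mono[of f e] by (meson not_less)

lemma wt_Suc: "i < d \<Longrightarrow> wt e < wt (e(i := Suc (e i)))"
  unfolding wt_def by (rule sum_strict_mono_ex1) (auto simp: distrib_left intro: less_imp_le l_pos)

lemma wt_inj: "wt e = wt f \<Longrightarrow> i < d \<Longrightarrow> e i = f i"
  using l_inj[of e f] unfolding wt_def by blast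

text \<open>Positive weights bound every coordinate below \<open>d\<close>. Only the values are
  finite in number, since coordinates from \<open>d\<close> on do not affect
  \<open>wt\<close>.\<close>

lemma finite_wt_le: "finite {wt e | e. wt e \<le> c}"
proof -
  define N where "N = nat \<lceil>\<Sum>i<d. \<bar>c\<bar> / l i\<rceil>"
  have "{wt e | e. wt e \<le> c} \<subseteq> wt ` PiE {..<d} (\<lambda>_. {..N})"
  proof
    fix v assume "v \<in> {wt e | e. wt e \<le> c}"
    then obtain e where e: "v = wt e" "wt e \<le> c" by blast
    have "e i \<le> N" if i: "i < d" for i
    proof -
      have "l i * real (e i) \<le> wt e"
        unfolding wt_def using i by (intro member_le_sum) (auto intro!: mult_nonneg_nonneg less_imp_le[OF l_pos])
      then have "real (e i) \<le> \<bar>c\<bar> / l i" using e(2) l_pos[OF i] by (simp add: field_simps)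
      also have "\<dots> \<le> (\<Sum>i<d. \<bar>c\<bar> / l i)"
        using i by (intro member_le_sum) (auto intro!: divide_nonneg_pos l_pos)
      finally show ?thesis unfolding N_def by linarith
    qed
    then have "restrict e {..<d} \<in> PiE {..<d} (\<lambda>_. {..N})" by auto
    moreover have "v = wt (restrict e {..<d})" unfolding e(1) wt_def by (rule sum.cong) auto
    ultimately show "v \<in> wt ` PiE {..<d} (\<lambda>_. {..N})" by blast
  qed
  then show ?thesis by (rule finite_subset) (intro finite_imageI finite_PiE, auto)
qed

lemma filt_mono: "c < c' \<Longrightarrow> filt c' \<subseteq> filt_strict c"
  by (rule mon_ideal_mono) auto

lemma filt_mult_filt:
  assumes "a \<in> filt c" "b \<in> filt c'" shows "a \<otimes> b \<in> filt (c + c')"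
proof (rule mult_Idl_Idl[OF mon_image_closed mon_image_closed mon_ideal_ideal _ assms])
  fix a b assume "a \<in> mon ` {e. c \<le> wt e}" "b \<in> mon ` {e. c' \<le> wt e}"
  then obtain e f where ef: "a = mon e" "b = mon f" "c \<le> wt e" "c' \<le> wt f" by auto
  then have "(\<lambda>i. e i + f i) \<in> {e. c + c' \<le> wt e}" by (simp add: wt_add)
  then show "a \<otimes> b \<in> filt (c + c')" unfolding ef(1,2) mon_add[symmetric] by (rule mon_in_mon_ideal) simp
qed

lemma filt_mult_filt_strict:
  assumes "a \<in> filt c" "b \<in> filt_strict c'" shows "a \<otimes> b \<in> filt_strict (c + c')"
proof (rule mult_Idl_Idl[OF mon_image_closed mon_image_closed mon_ideal_ideal _ assms])
  fix a b assume "a \<in> mon ` {e. c \<le> wt e}" "b \<in> mon ` {e. c' < wt e}"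
  then obtain e f where ef: "a = mon e" "b = mon f" "c \<le> wt e" "c' < wt f" by auto
  then have "(\<lambda>i. e i + f i) \<in> {e. c + c' < wt e}" by (simp add: wt_add)
  then show "a \<otimes> b \<in> filt_strict (c + c')" unfolding ef(1,2) mon_add[symmetric] by (rule mon_in_mon_ideal) simp
qed

lemma filt_pow: "r \<in> filt c \<Longrightarrow> r [^] k \<in> filt (real k * c)"
  by (rule mon_ideal_pow[where K = "\<lambda>c. {e. c \<le> wt e}"]) (auto simp: wt_add)

lemma ideal_pow_filt:
  assumes "ideal I R" "I \<subseteq> filt c" shows "ideal_pow R I n \<subseteq> filt (real n * c)"
proof (induction n)
  case 0
  have "u \<in> filt 0" if "u \<in> carrier R" for u
    using that by (intro mon_ideal_one[of "\<lambda>_. 0"]) (auto simp: wt_def)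
  then show ?case by auto
next
  case (Suc n)
  show ?case
  proof
    fix a assume "a \<in> ideal_pow R I (Suc n)"
    then have "a \<in> I \<cdot> ideal_pow R I n" by simp
    then show "a \<in> filt (real (Suc n) * c)"
    proof (induction rule: ideal_prod.induct)
      case (prod i j)
      then have "i \<otimes> j \<in> filt (c + real n * c)" using assms(2) Suc.IH by (intro filt_mult_filt) auto
      then show ?case by (simp add: distrib_right)
    next
      case (sum s1 s2)
      then show ?case by (intro ideal_add[OF mon_ideal_ideal])
    qed
  qed
qed

text \<open>The weight of the leading term is the largest weight \<open>c\<close> up to
  \<open>wt b\<close> with \<open>r\<close> in \<open>filt c\<close>. An element may lie in every
  \<open>filt c\<close>, so the hypothesis on \<open>b\<close> is what makes the search end.\<close>

lemma leading_term:
  assumes r: "r \<in> carrier R" "r \<notin> filt_strict (wt b)"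
  obtains f u s where "wt f \<le> wt b" "u \<in> carrier R" "u \<notin> param_ideal" "s \<in> filt_strict (wt f)"
    "r = s \<oplus> u \<otimes> mon f"
proof -
  define V where "V = {wt e | e. wt e \<le> wt b}"
  have finV: "finite V" unfolding V_def by (rule finite_wt_le)
  have "r \<in> filt 0" using r(1) by (intro mon_ideal_one[of "\<lambda>_. 0"]) (auto simp: wt_def)
  moreover have "0 \<in> V"
  proof -
    have "wt (\<lambda>_. 0) \<le> wt b" by (rule wt_mono) simp
    then show ?thesis unfolding V_def by (intro CollectI exI[of _ "\<lambda>_. 0"]) (simp add: wt_def)
  qed
  ultimately have ne: "{c \<in> V. r \<in> filt c} \<noteq> {}" by blast
  define c where "c = Max {c \<in> V. r \<in> filt c}"
  have c: "c \<in> V" "r \<in> filt c" using Max_in[OF _ ne] finV unfolding c_def by auto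
  have c_max: "c' \<le> c" if "c' \<in> V" "r \<in> filt c'" for c' unfolding c_def using finV that by (intro Max_ge) auto
  have r_not: "r \<notin> filt_strict c"
  proof
    assume rc: "r \<in> filt_strict c"
    show False
    proof (cases "{v \<in> V. c < v} = {}")
      case True
      have "filt_strict c \<subseteq> filt_strict (wt b)"
        by (rule mon_ideal_mono) (use True in \<open>force simp: V_def not_less\<close>)
      then show False using rc r(2) by blast
    next
      case False
      define m where "m = Min {v \<in> V. c < v}"
      have m: "m \<in> V" "c < m" using Min_in[OF _ False] finV unfolding m_def by auto
      have m_min: "m \<le> v" if "v \<in> V" "c < v" for v unfolding m_def using finV that by (intro Min_le) auto
      \<comment> \<open>No weight lies strictly between \<open>c\<close> and
        \<open>m\<close>.\<close>
      have "filt_strict c \<subseteq> filt m"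
      proof (rule mon_ideal_mono, rule subsetI)
        fix e assume e: "e \<in> {e. c < wt e}"
        show "e \<in> {e. m \<le> wt e}"
        proof (cases "wt e \<le> wt b")
          case True then show ?thesis using m_min[of "wt e"] e by (auto simp: V_def)
        next
          case False then show ?thesis using m(1) by (auto simp: V_def)
        qed
      qed
      then show False using c_max[OF m(1)] m(2) rc by auto
    qed
  qed
  obtain f where f: "c = wt f" "wt f \<le> wt b" using c(1) unfolding V_def by blast
  \<comment> \<open>By injectivity \<open>f\<close> gives the only monomial of weight
    \<open>c\<close>.\<close>
  have "filt c \<subseteq> mon_ideal (insert f {e. c < wt e})"
  proof (rule mon_ideal_subset)
    fix e assume "e \<in> {e. c \<le> wt e}"
    then consider "wt e = wt f" | "e \<in> {e. c < wt e}" unfolding f(1) by fastforce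
    then show "\<exists>h\<in>insert f {e. c < wt e}. \<forall>i<d. h i \<le> e i"
    proof cases
      case 1
      then show ?thesis by (intro bexI[of _ f]) (simp_all add: wt_inj[of e f])
    next
      case 2
      then show ?thesis by blast
    qed
  qed
  then have "r \<in> mon_ideal (insert f {e. c < wt e})" using c(2) by blast
  then obtain s u where su: "s \<in> filt_strict c" "u \<in> carrier R" "r = s \<oplus> u \<otimes> mon f"
    by (rule mon_ideal_insert_decomp)
  \<comment> \<open>A parameter factor would raise the weight and push the whole term into
    \<open>filt_strict c\<close>.\<close>
  have "u \<notin> param_ideal"
  proof
    assume u: "u \<in> param_ideal"
    have "mon f \<otimes> u \<in> filt_strict c"
    proof (rule mult_Idl_subset[OF _ mon_ideal_ideal _ _ u])
      fix a assume "a \<in> x ` {..<d}"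
      then obtain i where i: "i < d" "a = x i" by auto
      then have "mon f \<otimes> a = mon (f(i := Suc (f i)))" using mon_Suc[OF i(1)] x_closed by (simp add: m_comm)
      then show "mon f \<otimes> a \<in> filt_strict c"
        using wt_Suc[OF i(1), of f] f(1) by (auto intro: mon_in_mon_ideal[of "f(i := Suc (f i))"])
    qed (use x_closed in auto)
    then have "u \<otimes> mon f \<in> filt_strict c" using su(2) by (simp add: m_comm)
    then have "r \<in> filt_strict c" unfolding su(3) by (intro ideal_add[OF mon_ideal_ideal su(1)])
    then show False using r_not by simp
  qed
  then show thesis using that su f by blast
qed

text \<open>In a product of two such expansions every term involving a remainder has strictly larger
  weight, so only the product of the leading terms stays.\<close>

lemma leading_term_pow:
  assumes u: "u \<in> carrier R" and s: "s \<in> filt_strict (wt f)" and r: "r = s \<oplus> u \<otimes> mon f"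
  shows "\<exists>t \<in> filt_strict (real (Suc k) * wt f). r [^] Suc k = t \<oplus> u [^] Suc k \<otimes> mon (\<lambda>i. Suc k * f i)"
proof (induction k)
  case 0
  have "s \<in> carrier R" by (rule mon_ideal_carrier[OF s])
  then show ?case using s r u by (intro bexI[of _ s]) (auto simp: mon_closed)
next
  case (Suc k)
  then obtain t where t: "t \<in> filt_strict (real (Suc k) * wt f)"
    "r [^] Suc k = t \<oplus> u [^] Suc k \<otimes> mon (\<lambda>i. Suc k * f i)" by blast
  define v where "v = u [^] Suc k"
  define g where "g = mon (\<lambda>i. Suc k * f i)"
  define h where "h = mon f"
  have c: "t \<in> carrier R" "s \<in> carrier R" "v \<in> carrier R" "g \<in> carrier R" "h \<in> carrier R" "u \<in> carrier R"
    using mon_ideal_carrier[OF t(1)] mon_ideal_carrier[OF s] u by (auto simp: v_def g_def h_def)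
  have rc: "r \<in> carrier R" unfolding r using c by (simp add: h_def)
  have "mon f \<in> filt (wt f)" by (rule mon_in_mon_ideal[of f]) auto
  then have "u \<otimes> mon f \<in> filt (wt f)" using u by (intro ideal.I_l_closed[OF mon_ideal_ideal])
  moreover have "filt_strict (wt f) \<subseteq> filt (wt f)" by (rule mon_ideal_mono) auto
  ultimately have "r \<in> filt (wt f)" unfolding r using s by (intro ideal_add[OF mon_ideal_ideal]) auto
  then have 1: "r \<otimes> t \<in> filt_strict (wt f + real (Suc k) * wt f)" by (rule filt_mult_filt_strict[OF _ t(1)])
  have "g \<in> filt (real (Suc k) * wt f)" unfolding g_def by (rule mon_in_mon_ideal[of "\<lambda>i. Suc k * f i"]) (auto simp: wt_mult simp del: mult_Suc)
  then have "v \<otimes> g \<in> filt (real (Suc k) * wt f)" using c by (intro ideal.I_l_closed[OF mon_ideal_ideal])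
  then have 2: "(v \<otimes> g) \<otimes> s \<in> filt_strict (real (Suc k) * wt f + wt f)" by (rule filt_mult_filt_strict[OF _ s])
  have sum: "r \<otimes> t \<oplus> (v \<otimes> g) \<otimes> s \<in> filt_strict (real (Suc (Suc k)) * wt f)"
    using 1 2 by (intro ideal_add[OF mon_ideal_ideal]) (simp_all add: algebra_simps)
  have "r [^] Suc (Suc k) = (t \<oplus> v \<otimes> g) \<otimes> r" using t(2) by (simp add: v_def g_def)
  also have "\<dots> = r \<otimes> t \<oplus> (v \<otimes> g) \<otimes> (s \<oplus> u \<otimes> h)"
    using c rc r by (simp add: l_distr m_comm h_def)
  also have "\<dots> = (r \<otimes> t \<oplus> (v \<otimes> g) \<otimes> s) \<oplus> (v \<otimes> u) \<otimes> (g \<otimes> h)" using c rc by algebra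
  also have "g \<otimes> h = mon (\<lambda>i. Suc (Suc k) * f i)"
    unfolding g_def h_def mon_add[symmetric] by (rule mon_cong) simp
  also have "v \<otimes> u = u [^] Suc (Suc k)" by (simp add: v_def)
  finally show ?case using sum by blast
qed

text \<open>In the integral equation, trading \<open>i \<ge> 1\<close> factors
  \<open>r [^] q\<close> for \<open>c i\<close> strictly raises the weight bound, because
  \<open>real q * wt f < real p * m\<close>. So the top power of \<open>r\<close> lies strictly
  above the weight of its own leading term, which forces a power of \<open>u\<close> into the prime
  \<open>param_ideal\<close>.\<close>

lemma integral_weight_bound:
  assumes I: "ideal I R" "I \<subseteq> filt m" and r: "r \<in> carrier R" and q: "0 < q"
    and int: "r [^] q \<in> int_closure R (ideal_pow R I p)"
    and b: "real q * wt b < real p * m"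
  shows "r \<in> filt_strict (wt b)"
proof (rule ccontr)
  assume "r \<notin> filt_strict (wt b)"
  then obtain f u s where f: "wt f \<le> wt b" and u: "u \<in> carrier R" "u \<notin> param_ideal"
    and s: "s \<in> filt_strict (wt f)" and r_eq: "r = s \<oplus> u \<otimes> mon f"
    by (rule leading_term[OF r])
  let ?J = "ideal_pow R I p" and ?y = "r [^] q"
  have J: "ideal ?J R" by (rule ideal_pow_ideal[OF I(1)])
  have yc: "?y \<in> carrier R" using r by simp
  have qf: "real q * wt f < real p * m"
    using b f q by (smt (verit) mult_left_mono of_nat_0_le_iff)
  obtain n c where n: "1 \<le> n" and c: "\<And>i. i \<in> {1..n} \<Longrightarrow> c i \<in> ideal_pow R ?J i"
    and eq: "?y [^] n \<oplus> finsum R (\<lambda>i. c i \<otimes> ?y [^] (n - i)) {1..n} = \<zero>"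
    using int unfolding int_closure_def by blast
  let ?k = "q * n"
  have "mon f \<in> filt (wt f)" by (rule mon_in_mon_ideal[of f]) auto
  then have "u \<otimes> mon f \<in> filt (wt f)" using u by (intro ideal.I_l_closed[OF mon_ideal_ideal])
  moreover have "filt_strict (wt f) \<subseteq> filt (wt f)" by (rule mon_ideal_mono) auto
  ultimately have rf: "r \<in> filt (wt f)" unfolding r_eq using s by (intro ideal_add[OF mon_ideal_ideal]) auto
  have J_filt: "?J \<subseteq> filt (real p * m)" by (rule ideal_pow_filt[OF I])
  have terms: "c i \<otimes> ?y [^] (n - i) \<in> filt_strict (real ?k * wt f)" if i: "i \<in> {1..n}" for i
  proof -
    have "c i \<in> filt (real i * (real p * m))" using c[OF i] ideal_pow_filt[OF J J_filt] by blast
    moreover have "?y [^] (n - i) \<in> filt (real (q * (n - i)) * wt f)"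
      using filt_pow[OF rf, of "q * (n - i)"] r by (simp add: nat_pow_pow)
    ultimately have "c i \<otimes> ?y [^] (n - i) \<in> filt (real i * (real p * m) + real (q * (n - i)) * wt f)"
      by (rule filt_mult_filt)
    moreover have "real ?k * wt f < real i * (real p * m) + real (q * (n - i)) * wt f"
    proof -
      have "real i * (real q * wt f) < real i * (real p * m)" using qf i by simp
      moreover have "real ?k * wt f = real i * (real q * wt f) + real (q * (n - i)) * wt f"
        using i by (simp add: of_nat_diff algebra_simps)
      ultimately show ?thesis by linarith
    qed
    ultimately show ?thesis using filt_mono by blast
  qed
  then have sum: "finsum R (\<lambda>i. c i \<otimes> ?y [^] (n - i)) {1..n} \<in> filt_strict (real ?k * wt f)" (is "?S \<in> _")
    by (rule finsum_in_ideal[OF mon_ideal_ideal])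
  have Sc: "?S \<in> carrier R" by (rule mon_ideal_carrier[OF sum])
  have "\<ominus> ?S = ?y [^] n" using minus_equality[OF eq Sc] yc by simp
  then have "?y [^] n = \<zero> \<ominus> ?S" using Sc yc by (simp add: minus_eq)
  then have "?y [^] n \<in> filt_strict (real ?k * wt f)"
    using ideal_minus[OF mon_ideal_ideal ideal_zero[OF mon_ideal_ideal] sum] by simp
  then have rk: "r [^] ?k \<in> filt_strict (real ?k * wt f)" using r by (simp add: nat_pow_pow)
  obtain k where k: "?k = Suc k" using q n by (metis gr0_conv_Suc less_le_trans nat_0_less_mult_iff zero_less_one)
  obtain t where t: "t \<in> filt_strict (real ?k * wt f)" "r [^] ?k = t \<oplus> u [^] ?k \<otimes> mon (\<lambda>i. ?k * f i)"
    using leading_term_pow[OF u(1) s r_eq, of k] unfolding k by blast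
  have tc: "t \<in> carrier R" by (rule mon_ideal_carrier[OF t(1)])
  have "r [^] ?k \<ominus> t \<in> filt_strict (real ?k * wt f)" by (rule ideal_minus[OF mon_ideal_ideal rk t(1)])
  moreover have "r [^] ?k \<ominus> t = mon (\<lambda>i. ?k * f i) \<otimes> u [^] ?k"
    unfolding t(2) using tc u(1) by (intro add_minus_cancel_comm) auto
  ultimately have "mon (\<lambda>i. ?k * f i) \<otimes> u [^] ?k \<in> filt_strict (real ?k * wt f)" by simp
  then have "u [^] ?k \<in> param_ideal"
  proof (rule mon_coeff_in_param_ideal[rotated 2])
    show "\<exists>i<d. ?k * f i < g i" if "g \<in> {e. real ?k * wt f < wt e}" for g
      using wt_less_imp[of "\<lambda>i. ?k * f i" g] that by (simp only: mem_Collect_eq wt_mult)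
  qed (use u in simp)
  then show False using primeideal.prime_pow[OF prime_Idl[of "{..<d}"]] u by auto
qed

end

lemma (in monomial_system) rational_power_in_dilated:
  assumes fin: "finite A" "A \<noteq> {}" and r: "r \<in> carrier R" and pq: "0 < p" "0 < q"
    and int: "r [^] q \<in> int_closure R (ideal_pow R (mon_ideal A) p)"
  shows "r \<in> mon_ideal (dilated_exponents d A (real p / real q))"
proof (rule ccontr)
  let ?w = "real p / real q"
  assume "r \<notin> mon_ideal (dilated_exponents d A ?w)"
  then obtain b where b: "\<And>g. g \<in> dilated_exponents d A ?w \<Longrightarrow> \<exists>i<d. b i < g i"
    "r \<notin> mon_ideal {(\<lambda>_. 0)(i := Suc (b i)) | i. i < d}"
    using irreducible_component[OF r, of "dilated_exponents d A ?w"] by blast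
  have w_pos: "0 < ?w" using pq by simp
  have "b \<notin> dilated_exponents d A ?w" using b(1)[of b] by blast
  then obtain l :: "nat \<Rightarrow> real" where l: "\<And>i. i < d \<Longrightarrow> 0 < l i"
    "\<And>e f :: nat \<Rightarrow> nat. (\<Sum>i<d. l i * real (e i)) = (\<Sum>i<d. l i * real (f i)) \<Longrightarrow> \<forall>i<d. e i = f i"
    "\<And>a. a \<in> A \<Longrightarrow> (\<Sum>i<d. l i * real (b i)) < ?w * (\<Sum>i<d. l i * real (a i))"
    using exists_generic_weights[OF fin w_pos, of b d] by blast
  interpret weighted_monomial_system R x d l
    by unfold_locales (use l in blast)+
  define m where "m = Min (wt ` A)"
  have m: "m \<in> wt ` A" "\<And>a. a \<in> A \<Longrightarrow> m \<le> wt a" using fin unfolding m_def by auto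
  have "wt b < ?w * m" using l(3) m(1) unfolding wt_def by auto
  then have "real q * wt b < real p * m" using pq by (simp add: field_simps)
  moreover have "mon_ideal A \<subseteq> filt m" by (rule mon_ideal_mono) (use m(2) in auto)
  ultimately have "r \<in> filt_strict (wt b)"
    using integral_weight_bound[OF mon_ideal_ideal _ r pq(2) int] by blast
  \<comment> \<open>A weight above that of \<open>b\<close> forces some exponent above
    \<open>b i\<close>, so the ideal omitting \<open>r\<close> contains this part of the
    filtration.\<close>
  moreover have "filt_strict (wt b) \<subseteq> mon_ideal {(\<lambda>_. 0)(i := Suc (b i)) | i. i < d}"
  proof (rule mon_ideal_subset)
    fix g assume "g \<in> {e. wt b < wt e}"
    then obtain i where "i < d" "b i < g i" using wt_less_imp by blast
    then show "\<exists>h\<in>{(\<lambda>_. 0)(i := Suc (b i)) | i. i < d}. \<forall>j<d. h j \<le> g j"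
      by (intro bexI[of _ "(\<lambda>_. 0)(i := Suc (b i))"]) auto
  qed
  ultimately show False using b(2) by blast
qed

section \<open>From generalized regular systems of parameters to monomial systems\<close>

lemma exists_permutation_initial:
  assumes "S \<subseteq> {..<d}" "i < d" "i \<notin> S"
  obtains \<sigma> where "\<sigma> permutes {..<d}" "\<sigma> ` {..<card S} = S" "\<sigma> (card S) = i" "card S < d"
proof -
  have finS: "finite S" using assms(1) finite_subset by blast
  \<comment> \<open>\<open>S\<close> first and then \<open>i\<close>, so that regularity at position
    \<open>card S\<close> speaks about \<open>x i\<close> modulo the parameters indexed by
    \<open>S\<close>.\<close>
  define xs where "xs = sorted_list_of_set S @ [i] @ sorted_list_of_set ({..<d} - insert i S)"
  have dist: "distinct xs" and set: "set xs = {..<d}" using assms finS by (auto simp: xs_def)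
  have len: "length xs = d" using distinct_card[OF dist] set by simp
  define \<sigma> where "\<sigma> j = (if j < d then xs ! j else j)" for j
  have "bij_betw ((!) xs) {..<d} {..<d}" by (rule bij_betw_nth[OF dist]) (simp_all add: len set)
  then have "bij_betw \<sigma> {..<d} {..<d}" by (rule bij_betw_cong[THEN iffD1, rotated]) (simp add: \<sigma>_def)
  then have perm: "\<sigma> permutes {..<d}" by (rule bij_imp_permutes) (simp add: \<sigma>_def)
  have less: "card S < d"
    using assms finS psubset_card_mono[of "{..<d}" S] by auto
  have "\<sigma> ` {..<card S} = (!) xs ` {0..<card S}" using less by (intro image_cong) (auto simp: \<sigma>_def)
  also have "\<dots> = set (take (card S) xs)" by (rule nth_image) (use less len in simp)
  also have "\<dots> = S" using finS by (simp add: xs_def)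
  finally have "\<sigma> ` {..<card S} = S" .
  moreover have "\<sigma> (card S) = i" using less finS by (simp add: \<sigma>_def xs_def nth_append)
  ultimately show thesis using that perm less by blast
qed

lemma gen_reg_sop_monomial_system:
  fixes R (structure)
  assumes R: "regular_domain R" and x: "gen_reg_sop R x d"
  shows "monomial_system R x d"
proof -
  have "noetherian_ring R" "domain R" using R by (auto simp: regular_domain_def regular_ring_def)
  then interpret noetherian_domain R by (rule noetherian_domain.intro)
  have reg: "regular_seq R (x \<circ> \<sigma>) d" if "\<sigma> permutes {..<d}" for \<sigma>
    using x that unfolding gen_reg_sop_def permutable_regular_seq_def by blast
  have xc: "x i \<in> carrier R" if "i < d" for i
    using reg[OF permutes_id] that by (auto simp: regular_seq_def)
  have ideal: "ideal (Idl (x ` S)) R" if "S \<subseteq> {..<d}" for S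
    by (rule genideal_ideal) (use xc that in auto)
  have prime: "primeideal (Idl (x ` S)) R" if S: "S \<subseteq> {..<d}" for S
    using x S unfolding gen_reg_sop_def regular_domain_def by (intro quot_domain_imp_primeideal ideal) auto
  show ?thesis
  proof (intro monomial_system.intro monomial_system_axioms.intro noetherian_domain_axioms)
    show "x i \<notin> Idl (x ` S)" if S: "S \<subseteq> {..<d}" "i < d" "i \<notin> S" for S i
    proof
      assume mem: "x i \<in> Idl (x ` S)"
      obtain \<sigma> where \<sigma>: "\<sigma> permutes {..<d}" "\<sigma> ` {..<card S} = S" "\<sigma> (card S) = i" "card S < d"
        by (rule exists_permutation_initial[OF S])
      have "(x \<circ> \<sigma>) ` {..<card S} = x ` S" using \<sigma>(2) by (metis image_comp)
      \<comment> \<open>Regularity applied to the factor \<open>\<one>\<close>: a parameter that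
        vanishes in the quotient would make the quotient zero, against primality.\<close>
      then have "\<one> \<in> Idl (x ` S)"
        using reg[OF \<sigma>(1)] \<sigma>(3,4) mem xc[OF S(2)] unfolding regular_seq_def
        by (metis comp_apply one_closed r_one)
      then show False
        using ideal.one_imp_carrier[OF ideal[OF S(1)]] primeideal.I_notcarr[OF prime[OF S(1)]] by auto
    qed
  qed (use xc prime in auto)
qed

section \<open>Comparison with the scaled Newton polyhedron\<close>

lemma scaled_newton_polyhedron_iff:
  assumes "0 < w" "\<forall>i\<ge>d. e i = 0"
  shows "(\<lambda>i. real (e i)) \<in> scale_set w (newton_polyhedron d A) \<longleftrightarrow> e \<in> dilated_exponents d A w"
proof
  assume "(\<lambda>i. real (e i)) \<in> scale_set w (newton_polyhedron d A)"
  then obtain y lam where y: "(\<lambda>i. real (e i)) = (\<lambda>i. w * y i)" "\<forall>a\<in>A. 0 \<le> lam a" "(\<Sum>a\<in>A. lam a) = 1"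
    "\<forall>i<d. (\<Sum>a\<in>A. lam a * real (a i)) \<le> y i"
    unfolding scale_set_def newton_polyhedron_def by blast
  show "e \<in> dilated_exponents d A w"
  proof (rule dilated_exponentsI[of A "\<lambda>a. w * lam a"])
    fix i assume "i < d"
    then have "w * (\<Sum>a\<in>A. lam a * real (a i)) \<le> w * y i" using y(4) assms(1) by simp
    then show "(\<Sum>a\<in>A. w * lam a * real (a i)) \<le> real (e i)"
      using fun_cong[OF y(1), of i] by (simp add: sum_distrib_left mult.assoc)
  qed (use y assms in \<open>auto simp flip: sum_distrib_left\<close>)
next
  assume "e \<in> dilated_exponents d A w"
  then obtain lam where lam: "\<And>a. a \<in> A \<Longrightarrow> 0 \<le> lam a" "(\<Sum>a\<in>A. lam a) = w"
    "\<And>i. i < d \<Longrightarrow> (\<Sum>a\<in>A. lam a * real (a i)) \<le> real (e i)" using dilated_exponentsE by blast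
  have "(\<lambda>i. real (e i) / w) \<in> newton_polyhedron d A"
    unfolding newton_polyhedron_def
  proof (intro CollectI conjI exI[of _ "\<lambda>a. lam a / w"] allI impI ballI)
    show "(\<Sum>a\<in>A. lam a / w) = 1" using lam(2) assms(1) by (simp flip: sum_divide_distrib)
    show "(\<Sum>a\<in>A. lam a / w * real (a i)) \<le> real (e i) / w" if "i < d" for i
      using divide_right_mono[OF lam(3)[OF that], of w] assms(1) by (simp add: sum_divide_distrib)
  qed (use assms lam(1) in auto)
  then show "(\<lambda>i. real (e i)) \<in> scale_set w (newton_polyhedron d A)"
    unfolding scale_set_def using assms(1) by (intro image_eqI[of _ _ "\<lambda>i. real (e i) / w"]) auto
qed

theorem theorem5p5:
  fixes R :: "('a, 'b) ring_scheme" and x :: "nat \<Rightarrow> 'a" and d :: nat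
    and A :: "(nat \<Rightarrow> nat) set" and w :: rat
  assumes "regular_domain R"
    and "gen_reg_sop R x d"
    and "finite A" and "A \<noteq> {}"
    and "\<forall>a\<in>A. \<forall>i\<ge>d. a i = 0"
    and "w \<ge> 0"
  shows "rat_power_closure R (genideal R (monomial R x d ` A)) w =
         genideal R {monomial R x d e | e. (\<forall>i\<ge>d. e i = 0) \<and>
            (\<lambda>i. real (e i)) \<in> scale_set (of_rat w) (newton_polyhedron d A)}"
proof -
  interpret monomial_system R x d by (rule gen_reg_sop_monomial_system[OF assms(1,2)])
  define E where "E = {e. (\<forall>i\<ge>d. e i = 0) \<and> (\<lambda>i. real (e i)) \<in> scale_set (of_rat w) (newton_polyhedron d A)}"
  obtain p' q' where pq': "quotient_of w = (p', q')" by fastforce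
  have q'_pos: "0 < q'" by (rule quotient_of_denom_pos[OF pq'])
  have w_eq: "w = of_int p' / of_int q'" by (rule quotient_of_div[OF pq'])
  have p'_nn: "0 \<le> p'" using assms(6) q'_pos unfolding w_eq by (simp add: zero_le_divide_iff)
  define p where "p = nat p'"
  define q where "q = nat q'"
  have q: "0 < q" using q'_pos by (simp add: q_def)
  have w_real: "of_rat w = real p / real q"
    unfolding w_eq p_def q_def using p'_nn q'_pos by (simp add: of_rat_divide)
  have lhs: "rat_power_closure R (mon_ideal A) w = {r \<in> carrier R. r [^]\<^bsub>R\<^esub> q \<in> int_closure R (ideal_pow R (mon_ideal A) p)}"
    by (simp add: rat_power_closure_def pq' p_def q_def)
  have rhs: "mon_ideal E = mon_ideal (dilated_exponents d A (real p / real q))" (is "_ = mon_ideal ?D")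
  proof (cases "p = 0")
    case True
    \<comment> \<open>Scaling by zero collapses the polyhedron to the origin once it contains a
      vertex to scale; both ideals are then the unit ideal.\<close>
    have "(\<lambda>i. real ((\<lambda>_. 0) i)) \<in> scale_set 0 (newton_polyhedron d A)"
    proof -
      obtain a where a: "a \<in> A" using assms(4) by blast
      have "(\<lambda>i. real (a i)) \<in> newton_polyhedron d A"
        unfolding newton_polyhedron_def
        using assms(3,5) a
        by (intro CollectI conjI exI[of _ "\<lambda>b. if b = a then 1 else 0"])
          (auto simp: if_distrib[where f = "\<lambda>z. z * _"] cong: if_cong)
      then show ?thesis unfolding scale_set_def by (intro image_eqI[of _ _ "\<lambda>i. real (a i)"]) auto
    qed
    then have "(\<lambda>_. 0) \<in> E" using True by (simp add: E_def w_real)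
    moreover have "(\<lambda>_. 0) \<in> ?D" using True by (intro dilated_exponentsI[of A "\<lambda>_. 0"]) auto
    ultimately show ?thesis using mon_ideal_one mon_ideal_carrier by (metis subsetI subset_antisym)
  next
    case False
    then have w_pos: "0 < real p / real q" using q by simp
    show ?thesis
    proof (rule equalityI)
      have "E \<subseteq> ?D" using scaled_newton_polyhedron_iff[OF w_pos] unfolding E_def w_real by blast
      then show "mon_ideal E \<subseteq> mon_ideal ?D" by (rule mon_ideal_mono)
      show "mon_ideal ?D \<subseteq> mon_ideal E"
      proof (rule mon_ideal_subset)
        fix e assume e: "e \<in> ?D"
        \<comment> \<open>\<open>E\<close> requires zeros from \<open>d\<close> on while
          \<open>?D\<close> leaves these coordinates free; truncation does not change the
          monomial.\<close>
        define e' where "e' i = (if i < d then e i else 0)" for i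
        have "e' \<in> ?D" using e unfolding dilated_exponents_def e'_def by simp
        then have "e' \<in> E" using scaled_newton_polyhedron_iff[OF w_pos, of d e'] unfolding E_def w_real
          by (simp add: e'_def)
        then show "\<exists>h\<in>E. \<forall>i<d. h i \<le> e i" by (intro bexI[of _ e']) (auto simp: e'_def)
      qed
    qed
  qed
  have "{r \<in> carrier R. r [^]\<^bsub>R\<^esub> q \<in> int_closure R (ideal_pow R (mon_ideal A) p)} = mon_ideal ?D"
  proof (intro equalityI subsetI)
    fix r assume r: "r \<in> mon_ideal ?D"
    show "r \<in> {r \<in> carrier R. r [^]\<^bsub>R\<^esub> q \<in> int_closure R (ideal_pow R (mon_ideal A) p)}"
      using dilated_in_rational_power[OF assms(3,4) q r] mon_ideal_carrier[OF r] by simp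
  next
    fix r assume r: "r \<in> {r \<in> carrier R. r [^]\<^bsub>R\<^esub> q \<in> int_closure R (ideal_pow R (mon_ideal A) p)}"
    show "r \<in> mon_ideal ?D"
    proof (cases "p = 0")
      case True
      \<comment> \<open>For \<open>p = 0\<close> the dilate contains the zero exponent, so its ideal
        is all of \<open>R\<close>.\<close>
      then have "(\<lambda>_. 0) \<in> ?D" by (intro dilated_exponentsI[of A "\<lambda>_. 0"]) auto
      then show ?thesis using r by (intro mon_ideal_one) auto
    next
      case False
      then show ?thesis using rational_power_in_dilated[OF assms(3,4) _ _ q] r by blast
    qed
  qed
  then have "rat_power_closure R (mon_ideal A) w = mon_ideal E" using lhs rhs by simp
  moreover have "mon ` E = {mon e | e. (\<forall>i\<ge>d. e i = 0) \<and>
      (\<lambda>i. real (e i)) \<in> scale_set (of_rat w) (newton_polyhedron d A)}"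
    unfolding E_def by blast
  ultimately show ?thesis by simp
qed

end
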